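(* Let $k\ge 2$, let $\mathcal{Q}\subseteq \mathcal{P}([k])\setminus\{[k]\}$ and let $d\in[0,1]$. Then the properties $\mathrm{DISC}_{\mathcal{Q},d}$, $\mathrm{WDISC}_{\mathcal{Q},d}$, $\mathrm{CL}_{\mathcal{Q},d}$ and $\mathrm{DEV}_{\mathcal{Q},d}$ are all equivalent: a sequence $(H_n)_{n\in\mathbb{N}}$ of $k$-uniform hypergraphs, $H_n$ having $n$ vertices, satisfies one of them if and only if it satisfies each of the others.
   Context: Notation. $\mathcal{P}([k])$ is the power set of $[k]=\{1,\dots,k\}$. For a finite set $V$ and $Q\subseteq[k]$, $V^Q$ is the set of tuples $\mathbf{v}=(v_i)_{i\in Q}$ with entries in $V$ (entries may repeat). A $Q$-directed hypergraph on $V$ is a pair $(V,E)$ with $E\subseteq V^Q$. $\binom{V}{k}_<$ denotes the set of $k$-tuples $(v_1,\dots,v_k)$ of pairwise distinct elements of $V$. For $\mathbf{v}\in V^{[k]}$ and $Q\subseteq[k]$, $\mathbf{v}_Q=(v_i\colon i\in Q)$. For a family $\mathcal{G}=(G_Q)_{Q\in\mathcal{Q}}$ of $Q$-directed hypergraphs on $V$, a tuple $\mathbf{v}\in\binom{V}{k}_<$ is supported by $\mathcal{G}$ if $\mathbf{v}_Q\in E(G_Q)$ for every $Q\in\mathcal{Q}$; $\mathcal{K}_k(\mathcal{G})$ is the set of supported tuples. For a $k$-uniform hypergraph $H=(V,E)$, $\vec{E}\subseteq V^{[k]}$ is the set of all orderings of edges of $E$ (tuples of distinct vertices whose underlying set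 is an edge), and $\mathbb{1}_{\vec E}$ its indicator; $\mathbb{1}_E$ is the indicator of $E$ on $k$-sets. Let $H=(V,E)$ be a $k$-uniform hypergraph with $|V|=n$, $\varepsilon>0$, $d\in[0,1]$. - $\mathrm{DISC}_{\mathcal{Q},d}(\varepsilon)$: for every family $\mathcal{G}=(G_Q)_{Q\in\mathcal{Q}}$ of $Q$-directed hypergraphs on $V$, $\big||\vec E\cap\mathcal{K}_k(\mathcal{G})|-d|\mathcal{K}_k(\mathcal{G})|\big|\le\varepsilon n^k$. - $\mathrm{WDISC}_{\mathcal{Q},d}(\varepsilon)$: for every family of functions $w_Q\colon V^Q\to[-1,1]$ ($Q\in\mathcal{Q}$), with the convention that $w_Q(\mathbf{v}_Q)$ is taken to be $0$ whenever $\mathbf{v}_Q$ has repeated entries, $\big|\sum_{\mathbf{v}\in V^{[k]}}(\mathbb{1}_{\vec E}(\mathbf{v})-d)\prod_{Q\in\mathcal{Q}}w_Q(\mathbf{v}_Q)\big|\le\varepsilon n^k$. - A $k$-uniform hypergraph $F$ is $\mathcal{Q}$-simple if there is an ordering $f_1,\dots,f_m$ of its edges and, for each $i$, an ordering $f_i=\{x_{i_1},\dots,x_{i_k}\}$ of the vertices of $f_i$ (chosen independently for each edge), such that for every $h<i$ there is $Q\in\mathcal{Q}$ with $\{r\colon x_{i_r}\in f_h\cap f_i\}\subseteq Q$. - $\mathrm{CL}_{\mathcal{Q},d}(F,\varepsilon)$ (for a $\mathcal{Q}$-simple $k$-uniform $F$): $|N_F(H)-d^{e(F)}n^{v(F)}|\le\varepsilon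 n^{v(F)}$, where $N_F(H)$ is the number of labeled copies of $F$ in $H$ (injective maps $V(F)\to V$ sending edges to edges). - The hypergraph $M_{\mathcal{Q}}$: for a $k$-partite $k$-uniform $F$ with classes $X_1,\dots,X_k$ and $Q\subseteq[k]$, the $Q$-doubling $\mathrm{db}_Q(F)$ has classes $Y_q=X_q$ for $q\in Q$ and $Y_q=X_q\times\{0,1\}$ for $q\notin Q$, and edges all sets $\{x_q\colon q\in Q\}\cup\{(x_r,a)\colon r\in[k]\setminus Q\}$ with $\{x_1,\dots,x_k\}\in E(F)$ ($x_j\in X_j$) and $a\in\{0,1\}$. Doublings commute. $M_\emptyset$ is the single edge $k$-partite $k$-uniform hypergraph, and $M_{\mathcal{Q}}=\mathrm{db}_Q(M_{\mathcal{Q}\setminus\{Q\}})$ for $Q\in\mathcal{Q}$. - $\mathrm{DEV}_{\mathcal{Q},d}(\varepsilon)$: $\sum_M\prod_{f\in E(M)}(\mathbb{1}_E(f)-d)\le\varepsilon n^{v(M_{\mathcal{Q}})}$, where the sum ranges over all labeled copies $M$ of $M_{\mathcal{Q}}$ in the complete $k$-uniform hypergraph on $V$. A sequence $(H_n)_{n\in\mathbb N}$ of $k$-uniform hypergraphs ($H_n$ on $n$ vertices) satisfies one of these properties if, for every choice of the parameters ($\varepsilon>0$, and, for $\mathrm{CL}_{\mathcal{Q},d}$, every $\mathcal{Q}$-simple $k$-uniform hypergraph $F$), all but finitely many $H_n$ satisfy the property with those parameters.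
   Formalization: For empty 𝒬 the implication from DEV to the other properties is not claimed: DEV is then only a one-sided density bound, and edgeless H_n with d=1/2 satisfy DEV but not DISC. All other implications cover empty 𝒬 too; in CL, F has vertices in ℕ, which is no loss up to isomorphism. *)

theory Defs
  imports Complex_Main "HOL-Library.FuncSet" "HOL-Library.Indicator_Function"
begin

type_synonym 'a hypergraph = "'a set \<times> 'a set set"

abbreviation verts :: "'a hypergraph \<Rightarrow> 'a set" where "verts \<equiv> fst"
abbreviation edges :: "'a hypergraph \<Rightarrow> 'a set set" where "edges \<equiv> snd"

definition uniform :: "nat \<Rightarrow> 'a hypergraph \<Rightarrow> bool" where
  "uniform k H \<longleftrightarrow> finite (verts H) \<and> (\<forall>e\<in>edges H. e \<subseteq> verts H \<and> card e = k)"

text \<open>The index set \<open>[k]\<close> is \<open>{1..k}\<close>, and a tuple in \<open>V\<^sup>Q\<close> is an extensional function on \<open>Q\<close>,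
  so that passing from \<open>v\<close> to the subtuple indexed by \<open>Q\<close> is \<^const>\<open>restrict\<close>.\<close>

definition tuples :: "'a set \<Rightarrow> nat set \<Rightarrow> (nat \<Rightarrow> 'a) set" where
  "tuples V Q = (Q \<rightarrow>\<^sub>E V)"

definition distinct_tuples :: "'a set \<Rightarrow> nat \<Rightarrow> (nat \<Rightarrow> 'a) set" where
  "distinct_tuples V k = {v \<in> tuples V {1..k}. inj_on v {1..k}}"

text \<open>All orderings of the edges of a \<open>k\<close>-uniform hypergraph.\<close>

definition ordered_edges :: "nat \<Rightarrow> 'a hypergraph \<Rightarrow> (nat \<Rightarrow> 'a) set" where
  "ordered_edges k H = {v \<in> distinct_tuples (verts H) k. v ` {1..k} \<in> edges H}"


subsection \<open>Discrepancy\<close>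

text \<open>A family of \<open>Q\<close>-directed hypergraphs on a common vertex set \<open>V\<close> is given by its edge sets
  \<open>G Q \<subseteq> V\<^sup>Q\<close>; only the values at \<open>Q \<in> \<Q>\<close> matter.\<close>

definition directed_family :: "nat set set \<Rightarrow> 'a set \<Rightarrow> (nat set \<Rightarrow> (nat \<Rightarrow> 'a) set) \<Rightarrow> bool" where
  "directed_family \<Q> V G \<longleftrightarrow> (\<forall>Q\<in>\<Q>. G Q \<subseteq> tuples V Q)"

definition supported_tuples ::
  "nat \<Rightarrow> nat set set \<Rightarrow> 'a set \<Rightarrow> (nat set \<Rightarrow> (nat \<Rightarrow> 'a) set) \<Rightarrow> (nat \<Rightarrow> 'a) set" where
  "supported_tuples k \<Q> V G = {v \<in> distinct_tuples V k. \<forall>Q\<in>\<Q>. restrict v Q \<in> G Q}"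

definition DISC :: "nat \<Rightarrow> nat set set \<Rightarrow> real \<Rightarrow> real \<Rightarrow> 'a hypergraph \<Rightarrow> bool" where
  "DISC k \<Q> d \<epsilon> H \<longleftrightarrow>
     (\<forall>G. directed_family \<Q> (verts H) G \<longrightarrow>
        \<bar>real (card (ordered_edges k H \<inter> supported_tuples k \<Q> (verts H) G))
           - d * real (card (supported_tuples k \<Q> (verts H) G))\<bar>
        \<le> \<epsilon> * real (card (verts H)) ^ k)"


subsection \<open>Weighted discrepancy\<close>

text \<open>The conditional implements the convention that a weight counts as \<open>0\<close> on subtuples with
  repeated entries.  The sum itself runs over all tuples, including those with repetitions.\<close>

definition WDISC :: "nat \<Rightarrow> nat set set \<Rightarrow> real \<Rightarrow> real \<Rightarrow> 'a hypergraph \<Rightarrow> bool" where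
  "WDISC k \<Q> d \<epsilon> H \<longleftrightarrow>
     (\<forall>w :: nat set \<Rightarrow> (nat \<Rightarrow> 'a) \<Rightarrow> real.
        (\<forall>Q\<in>\<Q>. \<forall>u\<in>tuples (verts H) Q. w Q u \<in> {-1..1}) \<longrightarrow>
        \<bar>\<Sum>v\<in>tuples (verts H) {1..k}.
            (indicator (ordered_edges k H) v - d)
            * (\<Prod>Q\<in>\<Q>. if inj_on v Q then w Q (restrict v Q) else 0)\<bar>
        \<le> \<epsilon> * real (card (verts H)) ^ k)"


subsection \<open>Counting of simple hypergraphs\<close>

text \<open>Edges are numbered from \<open>0\<close>; \<open>x i\<close> is the ordering of the vertices of the \<open>i\<close>-th edge.\<close>

definition simple :: "nat \<Rightarrow> nat set set \<Rightarrow> 'b hypergraph \<Rightarrow> bool" where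
  "simple k \<Q> F \<longleftrightarrow> uniform k F \<and>
     (\<exists>(f :: 'b set list) (x :: nat \<Rightarrow> nat \<Rightarrow> 'b).
        distinct f \<and> set f = edges F \<and>
        (\<forall>i<length f. bij_betw (x i) {1..k} (f ! i)) \<and>
        (\<forall>i<length f. \<forall>h<i. \<exists>Q\<in>\<Q>. {r \<in> {1..k}. x i r \<in> f ! h \<inter> f ! i} \<subseteq> Q))"

definition injections :: "'b set \<Rightarrow> 'a set \<Rightarrow> ('b \<Rightarrow> 'a) set" where
  "injections X V = {\<phi> \<in> X \<rightarrow>\<^sub>E V. inj_on \<phi> X}"

definition labeled_copies :: "'b hypergraph \<Rightarrow> 'a hypergraph \<Rightarrow> ('b \<Rightarrow> 'a) set" where
  "labeled_copies F H = {\<phi> \<in> injections (verts F) (verts H). \<forall>f\<in>edges F. \<phi> ` f \<in> edges H}"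

definition CL :: "real \<Rightarrow> 'b hypergraph \<Rightarrow> real \<Rightarrow> 'a hypergraph \<Rightarrow> bool" where
  "CL d F \<epsilon> H \<longleftrightarrow>
     \<bar>real (card (labeled_copies F H))
        - d ^ card (edges F) * real (card (verts H)) ^ card (verts F)\<bar>
     \<le> \<epsilon> * real (card (verts H)) ^ card (verts F)"


subsection \<open>Deviation\<close>

text \<open>Iterated doublings need one vertex type closed under forming pairs \<open>(x, a)\<close> with
  \<open>a \<in> {0,1}\<close>: \<open>Orig i\<close> is the vertex of class \<open>i\<close> of the single edge one starts with, and
  \<open>Copy x a\<close> is the pair \<open>(x, a)\<close>.  A \<open>k\<close>-partite hypergraph is given by its classes
  \<open>X 1, \<dots>, X k\<close> and its edge set.\<close>

datatype dvertex = Orig nat | Copy dvertex bool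

type_synonym partite = "(nat \<Rightarrow> dvertex set) \<times> dvertex set set"

definition doubling :: "nat \<Rightarrow> nat set \<Rightarrow> partite \<Rightarrow> partite" where
  "doubling k Q F =
     ((\<lambda>q. if q \<in> Q then fst F q else {Copy x a | x a. x \<in> fst F q}),
      {x ` ({1..k} \<inter> Q) \<union> (\<lambda>r. Copy (x r) a) ` ({1..k} - Q) | x a.
         (\<forall>j\<in>{1..k}. x j \<in> fst F j) \<and> x ` {1..k} \<in> snd F})"

definition single_edge :: "nat \<Rightarrow> partite" where
  "single_edge k = ((\<lambda>i. {Orig i}), {Orig ` {1..k}})"

text \<open>Doublings commute up to isomorphism, so the order in which the members of \<open>\<Q>\<close> are
  processed is immaterial; an enumeration of \<open>\<Q>\<close> without repetitions is chosen arbitrarily.\<close>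

definition M_partite :: "nat \<Rightarrow> nat set set \<Rightarrow> partite" where
  "M_partite k \<Q> =
     foldr (doubling k) (SOME Qs. distinct Qs \<and> set Qs = \<Q>) (single_edge k)"

definition M_hypergraph :: "nat \<Rightarrow> nat set set \<Rightarrow> dvertex hypergraph" where
  "M_hypergraph k \<Q> = (\<Union>i\<in>{1..k}. fst (M_partite k \<Q>) i, snd (M_partite k \<Q>))"

text \<open>The labeled copies of \<open>M\<close> in the complete \<open>k\<close>-uniform hypergraph on \<open>V\<close> are exactly the
  injections of the vertex set of \<open>M\<close> into \<open>V\<close>.  There is no absolute value: for nonempty
  \<open>\<Q>\<close> the sum is nonnegative up to lower order terms, but for \<open>\<Q> = {}\<close>, where \<open>M\<close> is a single
  edge, the inequality bounds the density of \<open>H\<close> only from above and hence does not imply the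
  other properties.\<close>

definition DEV :: "nat \<Rightarrow> nat set set \<Rightarrow> real \<Rightarrow> real \<Rightarrow> 'a hypergraph \<Rightarrow> bool" where
  "DEV k \<Q> d \<epsilon> H \<longleftrightarrow>
     (let M = M_hypergraph k \<Q> in
        (\<Sum>\<phi>\<in>injections (verts M) (verts H). \<Prod>f\<in>edges M. (indicator (edges H) (\<phi> ` f) - d))
        \<le> \<epsilon> * real (card (verts H)) ^ card (verts M))"


subsection \<open>Properties of sequences\<close>

definition hypergraph_sequence :: "nat \<Rightarrow> (nat \<Rightarrow> 'a hypergraph) \<Rightarrow> bool" where
  "hypergraph_sequence k H \<longleftrightarrow> (\<forall>n. uniform k (H n) \<and> card (verts (H n)) = n)"

definition seq_DISC :: "nat \<Rightarrow> nat set set \<Rightarrow> real \<Rightarrow> (nat \<Rightarrow> 'a hypergraph) \<Rightarrow> bool" where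
  "seq_DISC k \<Q> d H \<longleftrightarrow> (\<forall>\<epsilon>>0. MOST n. DISC k \<Q> d \<epsilon> (H n))"

definition seq_WDISC :: "nat \<Rightarrow> nat set set \<Rightarrow> real \<Rightarrow> (nat \<Rightarrow> 'a hypergraph) \<Rightarrow> bool" where
  "seq_WDISC k \<Q> d H \<longleftrightarrow> (\<forall>\<epsilon>>0. MOST n. WDISC k \<Q> d \<epsilon> (H n))"

text \<open>Every finite hypergraph is isomorphic to one with vertices in \<^typ>\<open>nat\<close>, so nothing is
  lost by letting \<open>F\<close> range over the latter.\<close>

definition seq_CL :: "nat \<Rightarrow> nat set set \<Rightarrow> real \<Rightarrow> (nat \<Rightarrow> 'a hypergraph) \<Rightarrow> bool" where
  "seq_CL k \<Q> d H \<longleftrightarrow>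
     (\<forall>F :: nat hypergraph. simple k \<Q> F \<longrightarrow> (\<forall>\<epsilon>>0. MOST n. CL d F \<epsilon> (H n)))"

definition seq_DEV :: "nat \<Rightarrow> nat set set \<Rightarrow> real \<Rightarrow> (nat \<Rightarrow> 'a hypergraph) \<Rightarrow> bool" where
  "seq_DEV k \<Q> d H \<longleftrightarrow> (\<forall>\<epsilon>>0. MOST n. DEV k \<Q> d \<epsilon> (H n))"

end

theory Submission
  imports Defs
begin

text \<open>Up to an error of order \<open>1/n\<close>, all sums may range over arbitrary instead of injective maps, so
  every property becomes a statement about an average over maps into \<open>V\<close>, and all of them are compared
  with one weighted discrepancy.  Discrepancy is its restriction to \<open>{0,1}\<close>-valued weights, which
  suffices by multilinearity.  A \<open>\<Q>\<close>-simple hypergraph is counted by replacing its edges one at a time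
  by the density \<open>d\<close>: the other vertices being fixed, the earlier edges form a product of weights
  on the last edge.  Every subgraph of \<open>M\<^sub>\<Q>\<close> is \<open>\<Q>\<close>-simple, so expanding the product over its edges
  deduces deviation from counting.  Conversely, each application of the Cauchy--Schwarz
  inequality removes one weight \<open>w\<^sub>Q\<close> and performs one doubling \<open>db\<^sub>Q\<close>, until only the sum over
  \<open>M\<^sub>\<Q>\<close> is left.\<close>

subsection \<open>Averages over all maps into a finite set\<close>

text \<open>Sums over injective maps do not factor when the index set is split; averages over all
  maps do (\<open>avg_Un\<close>). This is what allows some vertices to be frozen and
  Cauchy--Schwarz to be applied to the rest. For the same reason the common notion
  \<open>avg_disc\<close> puts no condition on tuples with repeated entries: the weights that arise
  from frozen vertices do not vanish there. Deviation is an upper bound without absolute value, so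
  returning from it needs a lower bound on its sum. For nonempty \<open>\<Q>\<close> the sum over
  all maps is the upper bound of a last Cauchy--Schwarz step, hence at least a square. For empty
  \<open>\<Q>\<close> no such step exists, and counting a single edge leads back to discrepancy
  instead. The condition that \<open>[k]\<close> is not in \<open>\<Q>\<close> makes the
  \<open>2 ^ card \<Q>\<close> edges produced by the doublings pairwise distinct: doubling along
  \<open>[k]\<close> would repeat each edge, and a product over the set of edges would lose the
  multiplicities that Cauchy--Schwarz produces.\<close>

definition avg :: "'b set \<Rightarrow> 'a set \<Rightarrow> (('b \<Rightarrow> 'a) \<Rightarrow> real) \<Rightarrow> real" where
  "avg X V f = (\<Sum>\<phi>\<in>X \<rightarrow>\<^sub>E V. f \<phi>) / real (card V) ^ card X"

text \<open>Integrands are functions of total maps, and compositions or overridings of extensional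
  maps need not be extensional on the index set at hand. This predicate makes the values elsewhere
  harmless.\<close>

definition depends_on :: "'b set \<Rightarrow> (('b \<Rightarrow> 'a) \<Rightarrow> 'c) \<Rightarrow> bool" where
  "depends_on X f \<longleftrightarrow> (\<forall>\<phi> \<psi>. (\<forall>x\<in>X. \<phi> x = \<psi> x) \<longrightarrow> f \<phi> = f \<psi>)"

lemma depends_onD: "depends_on X f \<Longrightarrow> (\<And>x. x \<in> X \<Longrightarrow> \<phi> x = \<psi> x) \<Longrightarrow> f \<phi> = f \<psi>"
  unfolding depends_on_def by blast

lemma avg_cong: "(\<And>\<phi>. \<phi> \<in> X \<rightarrow>\<^sub>E V \<Longrightarrow> f \<phi> = g \<phi>) \<Longrightarrow> avg X V f = avg X V g"
  unfolding avg_def by (metis (mono_tags, lifting) sum.cong)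

lemma avg_add: "avg X V (\<lambda>\<phi>. f \<phi> + g \<phi>) = avg X V f + avg X V g"
  by (simp add: avg_def sum.distrib add_divide_distrib)

lemma avg_diff: "avg X V (\<lambda>\<phi>. f \<phi> - g \<phi>) = avg X V f - avg X V g"
  by (simp add: avg_def sum_subtractf diff_divide_distrib)

lemma avg_cmult: "avg X V (\<lambda>\<phi>. c * f \<phi>) = c * avg X V f"
  by (simp add: avg_def flip: sum_distrib_left)

lemma avg_mult_const: "avg X V (\<lambda>\<phi>. f \<phi> * c) = avg X V f * c"
  by (simp add: avg_def flip: sum_distrib_right)

lemma avg_sum: "avg X V (\<lambda>\<phi>. \<Sum>i\<in>I. f i \<phi>) = (\<Sum>i\<in>I. avg X V (f i))"
  unfolding avg_def by (subst sum.swap) (simp add: sum_divide_distrib)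

lemma avg_mono: "(\<And>\<phi>. \<phi> \<in> X \<rightarrow>\<^sub>E V \<Longrightarrow> f \<phi> \<le> g \<phi>) \<Longrightarrow> avg X V f \<le> avg X V g"
  unfolding avg_def by (intro divide_right_mono sum_mono) auto

lemma avg_const:
  assumes "finite X" "finite V" "V \<noteq> {}"
  shows "avg X V (\<lambda>_. c) = c"
  using assms by (simp add: avg_def card_PiE)

lemma abs_avg_le:
  assumes "finite X" "finite V" "V \<noteq> {}"
    and "\<And>\<phi>. \<phi> \<in> X \<rightarrow>\<^sub>E V \<Longrightarrow> \<bar>f \<phi>\<bar> \<le> C"
  shows "\<bar>avg X V f\<bar> \<le> C"
proof -
  have "avg X V f \<le> avg X V (\<lambda>_. C)"
    by (rule avg_mono) (use assms(4) in \<open>force simp: abs_le_iff\<close>)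
  moreover have "avg X V (\<lambda>_. - C) \<le> avg X V f"
    by (rule avg_mono) (use assms(4) in \<open>force simp: abs_le_iff\<close>)
  ultimately show ?thesis
    using assms by (simp add: avg_const abs_le_iff)
qed

text \<open>Nonnegativity of the variance; this is the only form of Cauchy--Schwarz in use.\<close>

lemma avg_square_le:
  assumes "finite X" "finite V" "V \<noteq> {}"
  shows "(avg X V f)\<^sup>2 \<le> avg X V (\<lambda>\<phi>. (f \<phi>)\<^sup>2)"
proof -
  define m where "m = avg X V f"
  have "avg X V (\<lambda>_. 0) \<le> avg X V (\<lambda>\<phi>. (f \<phi> - m)\<^sup>2)"
    by (rule avg_mono) simp
  also have "avg X V (\<lambda>\<phi>. (f \<phi> - m)\<^sup>2) = avg X V (\<lambda>\<phi>. ((f \<phi>)\<^sup>2 - (2 * m) * f \<phi>) + m\<^sup>2)"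
    by (rule avg_cong) (simp add: power2_eq_square algebra_simps)
  also have "\<dots> = avg X V (\<lambda>\<phi>. (f \<phi>)\<^sup>2) - 2 * m * m + m\<^sup>2"
    using assms by (simp add: avg_add avg_diff avg_cmult avg_const flip: m_def)
  finally show ?thesis
    using assms by (simp add: avg_const m_def power2_eq_square)
qed

text \<open>Fubini for normalised sums. The gluing \<open>override_on \<psi> \<phi> X\<close> takes
  \<open>\<phi>\<close> on \<open>X\<close> and \<open>\<psi>\<close> elsewhere.\<close>

lemma avg_Un:
  assumes "finite X" "finite Y" "X \<inter> Y = {}"
  shows "avg (X \<union> Y) V f = avg X V (\<lambda>\<phi>. avg Y V (\<lambda>\<psi>. f (override_on \<psi> \<phi> X)))"
proof -
  have "(\<Sum>\<phi>\<in>(X \<union> Y) \<rightarrow>\<^sub>E V. f \<phi>)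
      = (\<Sum>(\<phi>, \<psi>)\<in>(X \<rightarrow>\<^sub>E V) \<times> (Y \<rightarrow>\<^sub>E V). f (override_on \<psi> \<phi> X))"
  proof (rule sum.reindex_bij_witness
      [where i = "\<lambda>(\<phi>, \<psi>). override_on \<psi> \<phi> X" and j = "\<lambda>\<phi>. (restrict \<phi> X, restrict \<phi> Y)"])
    fix \<phi> assume \<phi>: "\<phi> \<in> (X \<union> Y) \<rightarrow>\<^sub>E V"
    show eq: "(case (restrict \<phi> X, restrict \<phi> Y) of (\<phi>, \<psi>) \<Rightarrow> override_on \<psi> \<phi> X) = \<phi>"
      using \<phi> by (auto simp: override_on_def fun_eq_iff PiE_def extensional_def)
    show "(case (restrict \<phi> X, restrict \<phi> Y) of (\<phi>, \<psi>) \<Rightarrow> f (override_on \<psi> \<phi> X)) = f \<phi>"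
      using eq by simp
    show "(restrict \<phi> X, restrict \<phi> Y) \<in> (X \<rightarrow>\<^sub>E V) \<times> (Y \<rightarrow>\<^sub>E V)"
      using \<phi> by (auto simp: PiE_def Pi_def)
  next
    fix p assume "p \<in> (X \<rightarrow>\<^sub>E V) \<times> (Y \<rightarrow>\<^sub>E V)"
    then obtain \<phi> \<psi> where p: "p = (\<phi>, \<psi>)" "\<phi> \<in> X \<rightarrow>\<^sub>E V" "\<psi> \<in> Y \<rightarrow>\<^sub>E V" by auto
    show "(restrict (case p of (\<phi>, \<psi>) \<Rightarrow> override_on \<psi> \<phi> X) X,
        restrict (case p of (\<phi>, \<psi>) \<Rightarrow> override_on \<psi> \<phi> X) Y) = p"
      using p assms(3) by (auto simp: override_on_def fun_eq_iff PiE_def extensional_def)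
    show "(case p of (\<phi>, \<psi>) \<Rightarrow> override_on \<psi> \<phi> X) \<in> (X \<union> Y) \<rightarrow>\<^sub>E V"
      using p by (auto simp: override_on_def PiE_def Pi_def extensional_def)
  qed
  also have "\<dots> = (\<Sum>\<phi>\<in>X \<rightarrow>\<^sub>E V. \<Sum>\<psi>\<in>Y \<rightarrow>\<^sub>E V. f (override_on \<psi> \<phi> X))"
    by (simp add: sum.cartesian_product)
  finally show ?thesis
    using assms by (simp add: avg_def card_Un_disjoint power_add field_simps sum_divide_distrib)
qed

lemma avg_reindex:
  assumes "inj_on h Y"
  shows "avg Y V f = avg (h ` Y) V (\<lambda>\<phi>. f (restrict (\<phi> \<circ> h) Y))"
proof -
  have "(\<Sum>\<phi>\<in>h ` Y \<rightarrow>\<^sub>E V. f (restrict (\<phi> \<circ> h) Y)) = (\<Sum>\<psi>\<in>Y \<rightarrow>\<^sub>E V. f \<psi>)"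
  proof (rule sum.reindex_bij_witness
      [where i = "\<lambda>\<psi>. restrict (\<psi> \<circ> the_inv_into Y h) (h ` Y)" and j = "\<lambda>\<phi>. restrict (\<phi> \<circ> h) Y"])
    fix \<phi> assume \<phi>: "\<phi> \<in> h ` Y \<rightarrow>\<^sub>E V"
    show "restrict (restrict (\<phi> \<circ> h) Y \<circ> the_inv_into Y h) (h ` Y) = \<phi>"
      using \<phi> assms by (auto simp: fun_eq_iff PiE_def extensional_def the_inv_into_f_f)
    show "restrict (\<phi> \<circ> h) Y \<in> Y \<rightarrow>\<^sub>E V"
      using \<phi> by (auto simp: PiE_def Pi_def)
  next
    fix \<psi> assume \<psi>: "\<psi> \<in> Y \<rightarrow>\<^sub>E V"
    show "restrict (restrict (\<psi> \<circ> the_inv_into Y h) (h ` Y) \<circ> h) Y = \<psi>"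
      using \<psi> assms by (auto simp: fun_eq_iff PiE_def extensional_def the_inv_into_f_f)
    show "restrict (\<psi> \<circ> the_inv_into Y h) (h ` Y) \<in> h ` Y \<rightarrow>\<^sub>E V"
      using \<psi> assms by (auto simp: PiE_def Pi_def the_inv_into_f_f)
  qed simp
  then show ?thesis
    using assms by (simp add: avg_def card_image)
qed

lemma avg_reindex_depends_on:
  assumes "inj_on h Y" "depends_on Y f"
  shows "avg (h ` Y) V (\<lambda>\<phi>. f (\<phi> \<circ> h)) = avg Y V f"
proof -
  have "f (restrict (\<phi> \<circ> h) Y) = f (\<phi> \<circ> h)" for \<phi> :: "'b \<Rightarrow> 'c"
    by (rule depends_onD[OF assms(2)]) auto
  then show ?thesis using avg_reindex[OF assms(1), of V f] by simp
qed

section \<open>Injective versus arbitrary maps\<close>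

text \<open>Union bound over the pairs \<open>x \<noteq> y\<close> that may collide: a map with
  \<open>\<phi> x = \<phi> y\<close> is determined by its values off \<open>y\<close>. The factor
  \<open>card V\<close> stands on the left to avoid the exponent \<open>card X - 1\<close>.\<close>

lemma card_noninjective_le:
  assumes "finite X" "finite V"
  shows "card ((X \<rightarrow>\<^sub>E V) - injections X V) * card V \<le> (card X)\<^sup>2 * card V ^ card X"
proof -
  define C where "C = (\<lambda>(x, y). {\<phi> \<in> X \<rightarrow>\<^sub>E V. \<phi> x = \<phi> y})"
  define D where "D = {(x, y). x \<in> X \<and> y \<in> X \<and> x \<noteq> y}"
  have D: "finite D" "card D \<le> (card X)\<^sup>2"
  proof -
    have "D \<subseteq> X \<times> X" by (auto simp: D_def)
    with assms(1) show "finite D" by (meson finite_SigmaI finite_subset)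
    show "card D \<le> (card X)\<^sup>2"
      using card_mono[OF _ \<open>D \<subseteq> X \<times> X\<close>] assms(1) by (simp add: card_cartesian_product power2_eq_square)
  qed
  have fin: "finite (X \<rightarrow>\<^sub>E V)" using assms by (simp add: finite_PiE)
  have C: "card (C p) * card V \<le> card V ^ card X" if "p \<in> D" for p
  proof -
    obtain x y where p: "p = (x, y)" "x \<in> X" "y \<in> X" "x \<noteq> y" using \<open>p \<in> D\<close> by (auto simp: D_def)
    have "inj_on (\<lambda>\<phi>. restrict \<phi> (X - {y})) (C p)"
    proof (rule inj_onI)
      fix \<phi> \<psi> assume 1: "\<phi> \<in> C p" "\<psi> \<in> C p" "restrict \<phi> (X - {y}) = restrict \<psi> (X - {y})"
      have "\<phi> z = \<psi> z" if "z \<in> X - {y}" for z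
        using fun_cong[OF 1(3), of z] that by simp
      moreover from this[of x] have "\<phi> y = \<psi> y" using 1 p by (auto simp: C_def)
      ultimately have "\<forall>z\<in>X. \<phi> z = \<psi> z" by blast
      then show "\<phi> = \<psi>"
        using 1(1,2) by (intro PiE_ext[of \<phi> X "\<lambda>_. V" \<psi>]) (auto simp: C_def p)
    qed
    moreover have "(\<lambda>\<phi>. restrict \<phi> (X - {y})) ` C p \<subseteq> (X - {y}) \<rightarrow>\<^sub>E V"
      by (auto simp: C_def p PiE_def Pi_def)
    ultimately have "card (C p) \<le> card ((X - {y}) \<rightarrow>\<^sub>E V)"
      by (rule card_inj_on_le) (use assms in \<open>simp add: finite_PiE\<close>)
    also have "\<dots> = card V ^ (card X - 1)"
      using assms p by (simp add: card_PiE)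
    finally have "card (C p) * card V \<le> card V ^ (card X - 1) * card V" by simp
    also have "\<dots> = card V ^ card X"
      using p assms by (metis One_nat_def Suc_pred card_gt_0_iff empty_iff mult.commute power_Suc)
    finally show ?thesis .
  qed
  have "(X \<rightarrow>\<^sub>E V) - injections X V \<subseteq> (\<Union>p\<in>D. C p)"
    by (auto simp: injections_def inj_on_def C_def D_def)
  then have "card ((X \<rightarrow>\<^sub>E V) - injections X V) \<le> card (\<Union>p\<in>D. C p)"
    by (rule card_mono[rotated]) (use D(1) fin in \<open>auto simp: C_def\<close>)
  also have "\<dots> \<le> (\<Sum>p\<in>D. card (C p))" by (rule card_UN_le[OF D(1)])
  finally have "card ((X \<rightarrow>\<^sub>E V) - injections X V) * card V \<le> (\<Sum>p\<in>D. card (C p)) * card V" by simp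
  also have "\<dots> = (\<Sum>p\<in>D. card (C p) * card V)" by (simp add: sum_distrib_right)
  also have "\<dots> \<le> (\<Sum>p\<in>D. card V ^ card X)" by (intro sum_mono C)
  also have "\<dots> \<le> (card X)\<^sup>2 * card V ^ card X" using D(2) by simp
  finally show ?thesis .
qed

text \<open>Source of every \<open>1/n\<close> error. The injective sum is normalised by the number
  of all maps, as in the definitions of the four properties.\<close>

lemma avg_injections_approx:
  assumes "finite X" "finite V" "V \<noteq> {}"
    and bound: "\<And>\<phi>. \<phi> \<in> X \<rightarrow>\<^sub>E V \<Longrightarrow> \<bar>f \<phi>\<bar> \<le> 1"
  shows "\<bar>avg X V f - (\<Sum>\<phi>\<in>injections X V. f \<phi>) / real (card V) ^ card X\<bar>
    \<le> real ((card X)\<^sup>2) / real (card V)"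
proof -
  let ?n = "real (card V)"
  have n: "?n > 0" using assms by (simp add: card_gt_0_iff)
  have fin: "finite (X \<rightarrow>\<^sub>E V)" using assms by (simp add: finite_PiE)
  have "(\<Sum>\<phi>\<in>X \<rightarrow>\<^sub>E V. f \<phi>) - (\<Sum>\<phi>\<in>injections X V. f \<phi>)
      = (\<Sum>\<phi>\<in>(X \<rightarrow>\<^sub>E V) - injections X V. f \<phi>)"
    by (subst sum_diff) (use fin in \<open>auto simp: injections_def\<close>)
  moreover have "\<bar>\<Sum>\<phi>\<in>(X \<rightarrow>\<^sub>E V) - injections X V. f \<phi>\<bar> \<le> real (card ((X \<rightarrow>\<^sub>E V) - injections X V)) * 1"
    by (rule order_trans[OF sum_abs sum_bounded_above]) (use bound in auto)
  ultimately have "\<bar>(\<Sum>\<phi>\<in>X \<rightarrow>\<^sub>E V. f \<phi>) - (\<Sum>\<phi>\<in>injections X V. f \<phi>)\<bar> * ?n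
      \<le> real (card ((X \<rightarrow>\<^sub>E V) - injections X V) * card V)"
    using n by simp
  also have "\<dots> \<le> real ((card X)\<^sup>2 * card V ^ card X)"
    using card_noninjective_le[OF assms(1,2)] of_nat_le_iff by blast
  finally have "\<bar>(\<Sum>\<phi>\<in>X \<rightarrow>\<^sub>E V. f \<phi>) - (\<Sum>\<phi>\<in>injections X V. f \<phi>)\<bar> / ?n ^ card X
      \<le> real ((card X)\<^sup>2) / ?n"
    using n by (simp add: field_simps)
  then show ?thesis
    using n by (simp add: avg_def diff_divide_distrib[symmetric])
qed

text \<open>The Cauchy--Schwarz step behind doublings: a weight depending only on the part \<open>A\<close> that is
  not copied can be dropped at the price of squaring.\<close>

lemma avg_doubling:
  fixes c :: "bool \<Rightarrow> 'b \<Rightarrow> 'b" and W F :: "('b \<Rightarrow> 'a) \<Rightarrow> real"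
  assumes fin: "finite A" "finite B" "finite V" "V \<noteq> {}" and AB: "A \<inter> B = {}"
    and inj: "\<And>b. inj_on (c b) B"
    and disj: "c True ` B \<inter> c False ` B = {}" "\<And>b. A \<inter> c b ` B = {}"
    and F: "depends_on (A \<union> B) F"
    and W: "depends_on A W" and W_le: "\<And>\<phi>. \<bar>W \<phi>\<bar> \<le> 1"
  defines "\<iota> \<equiv> \<lambda>b x. if x \<in> A then x else c b x"
  shows "(avg (A \<union> B) V (\<lambda>\<phi>. W \<phi> * F \<phi>))\<^sup>2
    \<le> avg (A \<union> (c True ` B \<union> c False ` B)) V (\<lambda>\<phi>. F (\<phi> \<circ> \<iota> True) * F (\<phi> \<circ> \<iota> False))"
proof -
  define G where "G = (\<lambda>\<alpha>. avg B V (\<lambda>\<beta>. F (override_on \<beta> \<alpha> A)))"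
  have copy: "avg (c b ` B) V (\<lambda>\<beta>. F (override_on (\<beta> \<circ> c b) \<alpha> A)) = G \<alpha>" for b \<alpha>
    unfolding G_def
    by (rule avg_reindex_depends_on[OF inj], unfold depends_on_def, intro allI impI,
        rule depends_onD[OF F]) (auto simp: override_on_def)
  have "avg (A \<union> B) V (\<lambda>\<phi>. W \<phi> * F \<phi>) = avg A V (\<lambda>\<alpha>. W \<alpha> * G \<alpha>)"
  proof -
    have "W (override_on \<beta> \<alpha> A) = W \<alpha>" for \<alpha> \<beta>
      by (rule depends_onD[OF W]) auto
    then show ?thesis using fin AB by (simp add: avg_Un G_def avg_cmult)
  qed
  then have "(avg (A \<union> B) V (\<lambda>\<phi>. W \<phi> * F \<phi>))\<^sup>2 \<le> avg A V (\<lambda>\<alpha>. (W \<alpha> * G \<alpha>)\<^sup>2)"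
    using avg_square_le[OF fin(1,3,4)] by simp
  also have "\<dots> \<le> avg A V (\<lambda>\<alpha>. (G \<alpha>)\<^sup>2)"
  proof (rule avg_mono)
    fix \<alpha>
    have "(W \<alpha>)\<^sup>2 \<le> 1" using W_le[of \<alpha>] by (simp add: abs_square_le_1)
    then show "(W \<alpha> * G \<alpha>)\<^sup>2 \<le> (G \<alpha>)\<^sup>2"
      by (simp add: power_mult_distrib mult_left_le_one_le)
  qed
  \<comment> \<open>The square of the inner average \<open>G\<close> is a product of averages over
    two disjoint copies of \<open>B\<close>, and so a single average over both copies.\<close>
  also have "\<dots> = avg (A \<union> (c True ` B \<union> c False ` B)) V
      (\<lambda>\<phi>. F (\<phi> \<circ> \<iota> True) * F (\<phi> \<circ> \<iota> False))"
  proof -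
    have T: "F (override_on (override_on \<beta>' \<beta> (c True ` B)) \<alpha> A \<circ> \<iota> True)
        = F (override_on (\<beta> \<circ> c True) \<alpha> A)" for \<alpha> \<beta> \<beta>' :: "'b \<Rightarrow> 'a"
      by (rule depends_onD[OF F]) (use AB disj(2)[of True] in \<open>auto simp: override_on_def \<iota>_def\<close>)
    have F': "F (override_on (override_on \<beta>' \<beta> (c True ` B)) \<alpha> A \<circ> \<iota> False)
        = F (override_on (\<beta>' \<circ> c False) \<alpha> A)" for \<alpha> \<beta> \<beta>' :: "'b \<Rightarrow> 'a"
      by (rule depends_onD[OF F])
        (use AB disj(1) disj(2)[of False] in \<open>auto simp: override_on_def \<iota>_def\<close>)
    have "avg (A \<union> (c True ` B \<union> c False ` B)) V (\<lambda>\<phi>. F (\<phi> \<circ> \<iota> True) * F (\<phi> \<circ> \<iota> False))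
        = avg A V (\<lambda>\<alpha>. avg (c True ` B) V (\<lambda>\<beta>. avg (c False ` B) V
            (\<lambda>\<beta>'. F (override_on (\<beta> \<circ> c True) \<alpha> A) * F (override_on (\<beta>' \<circ> c False) \<alpha> A))))"
      using fin disj by (subst avg_Un; simp add: Int_Un_distrib avg_Un T F')
    also have "\<dots> = avg A V (\<lambda>\<alpha>. (G \<alpha>)\<^sup>2)"
      by (simp add: avg_cmult avg_mult_const copy power2_eq_square)
    finally show ?thesis by simp
  qed
  finally show ?thesis .
qed

subsection \<open>Weighted discrepancy as an average\<close>

text \<open>The edge is read off the image set instead of \<open>ordered_edges\<close>, the form
  shared with counting and deviation. In a uniform hypergraph the two agree, since an image of size
  \<open>k\<close> forces injectivity.\<close>

definition weighted_term ::
  "nat \<Rightarrow> 'a set set \<Rightarrow> real \<Rightarrow> nat set set \<Rightarrow> (nat set \<Rightarrow> (nat \<Rightarrow> 'a) \<Rightarrow> real) \<Rightarrow> (nat \<Rightarrow> 'a) \<Rightarrow> real" where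
  "weighted_term k E d \<Q> w v = (indicator E (v ` {1..k}) - d) * (\<Prod>Q\<in>\<Q>. w Q (restrict v Q))"

definition avg_disc :: "nat \<Rightarrow> nat set set \<Rightarrow> real \<Rightarrow> real \<Rightarrow> 'a hypergraph \<Rightarrow> bool" where
  "avg_disc k \<Q> d \<epsilon> H \<longleftrightarrow>
     (\<forall>w. (\<forall>Q u. \<bar>w Q u\<bar> \<le> 1) \<longrightarrow>
        \<bar>avg {1..k} (verts H) (weighted_term k (edges H) d \<Q> w)\<bar> \<le> \<epsilon>)"

lemma avg_discD:
  assumes "avg_disc k \<Q> d \<epsilon> H" "\<And>Q u. \<bar>w Q u\<bar> \<le> 1"
  shows "\<bar>avg {1..k} (verts H) (weighted_term k (edges H) d \<Q> w)\<bar> \<le> \<epsilon>"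
  using assms by (simp add: avg_disc_def)

lemma abs_prod_le_1:
  fixes f :: "'b \<Rightarrow> real"
  assumes "\<And>i. i \<in> I \<Longrightarrow> \<bar>f i\<bar> \<le> 1"
  shows "\<bar>\<Prod>i\<in>I. f i\<bar> \<le> 1"
  unfolding abs_prod by (rule prod_le_1) (use assms in auto)

lemma abs_indicator_minus_le_1: "d \<in> {0..1} \<Longrightarrow> \<bar>indicator E x - d\<bar> \<le> (1 :: real)"
  by (auto simp: indicator_def)

lemma abs_weighted_term_le_1:
  assumes "d \<in> {0..1}" "\<And>Q u. \<bar>w Q u\<bar> \<le> 1"
  shows "\<bar>weighted_term k E d \<Q> w v\<bar> \<le> 1"
  unfolding weighted_term_def abs_mult
  by (intro mult_le_one abs_indicator_minus_le_1 abs_prod_le_1 assms) auto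

lemma weighted_term_depends_on:
  assumes "\<Q> \<subseteq> Pow {1..k}"
  shows "depends_on {1..k} (weighted_term k E d \<Q> w)"
  unfolding depends_on_def
proof (intro allI impI)
  fix u v :: "nat \<Rightarrow> 'a" assume uv: "\<forall>x\<in>{1..k}. u x = v x"
  have "restrict u Q = restrict v Q" if "Q \<in> \<Q>" for Q
    using uv assms that by (intro restrict_ext) blast
  moreover have "u ` {1..k} = v ` {1..k}" using uv by force
  ultimately show "weighted_term k E d \<Q> w u = weighted_term k E d \<Q> w v"
    by (simp add: weighted_term_def)
qed

text \<open>Bundles what passing to large \<open>n\<close> requires: a nonempty vertex set and a
  small error term. Instances with \<open>c = 0\<close> serve for the former.\<close>

lemma MOST_const_div_le:
  assumes "\<epsilon> > 0"
  shows "MOST n. n > 0 \<and> c / real n \<le> \<epsilon>"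
proof -
  have "((\<lambda>n. c / real n) \<longlongrightarrow> 0) sequentially"
    by (rule lim_const_over_n)
  then have "eventually (\<lambda>n. c / real n < \<epsilon>) sequentially"
    using assms by (rule order_tendstoD)
  then show ?thesis
    unfolding cofinite_eq_sequentially using eventually_gt_at_top[of 0]
    by eventually_elim simp
qed

text \<open>Each weight in turn contributes a factor 2: a linear functional of one weight is extremal at
  signs, and the positive and negative coefficients are treated separately.\<close>

lemma multilinear_weight_bound:
  fixes c :: "'v \<Rightarrow> real" and r :: "'q \<Rightarrow> 'v \<Rightarrow> 'u"
  assumes "finite \<Q>" "finite T"
    and "\<And>w. (\<And>Q u. w Q u \<in> {0, 1}) \<Longrightarrow> \<bar>\<Sum>v\<in>T. c v * (\<Prod>Q\<in>\<Q>. w Q (r Q v))\<bar> \<le> B"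
    and "\<And>Q u. \<bar>w Q u\<bar> \<le> 1"
  shows "\<bar>\<Sum>v\<in>T. c v * (\<Prod>Q\<in>\<Q>. w Q (r Q v))\<bar> \<le> 2 ^ card \<Q> * B"
  using assms(1,3)
proof (induction \<Q> arbitrary: c B rule: finite_induct)
  case empty
  from empty[of "\<lambda>_ _. 0"] show ?case by simp
next
  case (insert Q \<Q>)
  \<comment> \<open>The real weight at \<open>Q\<close> moves into the coefficients while the other
    weights stay 0/1-valued, so that the induction hypothesis applies with \<open>2 * B\<close> in
    place of \<open>B\<close>.\<close>
  have "\<bar>\<Sum>v\<in>T. (c v * w Q (r Q v)) * (\<Prod>Q\<in>\<Q>. w' Q (r Q v))\<bar> \<le> 2 * B"
    if w': "\<And>Q u. w' Q u \<in> {0, 1}" for w' :: "'q \<Rightarrow> 'u \<Rightarrow> real"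
  proof -
    define b where "b = (\<lambda>v. c v * (\<Prod>Q\<in>\<Q>. w' Q (r Q v)))"
    \<comment> \<open>Grouping the tuples by their \<open>Q\<close>-part exhibits the sum as a
      linear functional of the single weight at \<open>Q\<close>.\<close>
    define s where "s = (\<lambda>u. \<Sum>v\<in>{v\<in>T. r Q v = u}. b v)"
    have group: "(\<Sum>v\<in>T. b v * g (r Q v)) = (\<Sum>u\<in>r Q ` T. g u * s u)" for g :: "'u \<Rightarrow> real"
    proof -
      have "(\<Sum>v\<in>T. b v * g (r Q v)) = (\<Sum>u\<in>r Q ` T. \<Sum>v\<in>{v\<in>T. r Q v = u}. b v * g (r Q v))"
        using assms(2) by (rule sum.image_gen)
      also have "\<dots> = (\<Sum>u\<in>r Q ` T. g u * s u)"
        unfolding s_def sum_distrib_left by (intro sum.cong) auto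
      finally show ?thesis .
    qed
    have zero_one: "\<bar>\<Sum>u\<in>r Q ` T. g u * s u\<bar> \<le> B" if "\<And>u. g u \<in> {0, 1}" for g
    proof -
      have "(\<Sum>v\<in>T. c v * (\<Prod>Q'\<in>insert Q \<Q>. (w'(Q := g)) Q' (r Q' v))) = (\<Sum>v\<in>T. b v * g (r Q v))"
      proof (rule sum.cong[OF refl])
        fix v
        have "(\<Prod>Q'\<in>\<Q>. (w'(Q := g)) Q' (r Q' v)) = (\<Prod>Q\<in>\<Q>. w' Q (r Q v))"
          using insert.hyps by (intro prod.cong) auto
        then show "c v * (\<Prod>Q'\<in>insert Q \<Q>. (w'(Q := g)) Q' (r Q' v)) = b v * g (r Q v)"
          using insert.hyps by (simp add: b_def)
      qed
      moreover have "\<bar>\<Sum>v\<in>T. c v * (\<Prod>Q'\<in>insert Q \<Q>. (w'(Q := g)) Q' (r Q' v))\<bar> \<le> B"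
        using w' that by (intro insert.prems) auto
      ultimately show ?thesis using group[of g] by simp
    qed
    have "\<bar>\<Sum>v\<in>T. (c v * w Q (r Q v)) * (\<Prod>Q\<in>\<Q>. w' Q (r Q v))\<bar> = \<bar>\<Sum>v\<in>T. b v * w Q (r Q v)\<bar>"
      by (simp add: b_def mult_ac)
    also have "\<dots> \<le> (\<Sum>u\<in>r Q ` T. \<bar>w Q u * s u\<bar>)"
      unfolding group by (rule sum_abs)
    also have "\<dots> \<le> (\<Sum>u\<in>r Q ` T. \<bar>s u\<bar>)"
      using assms(4) by (intro sum_mono) (simp add: abs_mult mult_left_le_one_le)
    also have "\<dots> = (\<Sum>u\<in>r Q ` T. of_bool (s u > 0) * s u) - (\<Sum>u\<in>r Q ` T. of_bool (s u \<le> 0) * s u)"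
      unfolding sum_subtractf[symmetric] by (intro sum.cong) auto
    also have "\<dots> \<le> B + B"
      using zero_one[of "\<lambda>u. of_bool (s u > 0)"] zero_one[of "\<lambda>u. of_bool (s u \<le> 0)"] by auto
    finally show ?thesis by simp
  qed
  then have "\<bar>\<Sum>v\<in>T. (c v * w Q (r Q v)) * (\<Prod>Q\<in>\<Q>. w Q (r Q v))\<bar> \<le> 2 ^ card \<Q> * (2 * B)"
    by (rule insert.IH[of "\<lambda>v. c v * w Q (r Q v)" "2 * B"])
  then show ?case using insert.hyps by (simp add: mult_ac)
qed

lemma distinct_tuples_eq_injections: "distinct_tuples V k = injections {1..k} V"
  by (auto simp: distinct_tuples_def injections_def tuples_def)

lemma finite_index_family: "\<Q> \<subseteq> Pow {1..k :: nat} \<Longrightarrow> finite \<Q>"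
  by (rule finite_subset) auto

lemma indicator_ordered_edges:
  assumes H: "uniform k H" and v: "v \<in> tuples (verts H) {1..k}"
  shows "(indicator (ordered_edges k H) v :: real) = indicator (edges H) (v ` {1..k})"
proof -
  have "inj_on v {1..k}" if "v ` {1..k} \<in> edges H"
    using H that by (auto simp: uniform_def intro: eq_card_imp_inj_on)
  then show ?thesis
    using v by (auto simp: ordered_edges_def distinct_tuples_def indicator_def)
qed

text \<open>A product of indicators is the indicator of a conjunction, here of being
  supported.\<close>

lemma disc_sum:
  fixes G :: "nat set \<Rightarrow> (nat \<Rightarrow> 'a) set" and H :: "'a hypergraph"
  assumes \<Q>: "\<Q> \<subseteq> Pow {1..k}" and H: "uniform k H"
  shows "(\<Sum>v\<in>injections {1..k} (verts H). weighted_term k (edges H) d \<Q> (\<lambda>Q. indicator (G Q)) v)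
    = real (card (ordered_edges k H \<inter> supported_tuples k \<Q> (verts H) G))
      - d * real (card (supported_tuples k \<Q> (verts H) G))"
proof -
  let ?I = "injections {1..k} (verts H)" and ?K = "supported_tuples k \<Q> (verts H) G"
  have fin: "finite ?I"
    using H by (simp add: injections_def uniform_def finite_PiE)
  have K: "?K \<subseteq> ?I" by (auto simp: supported_tuples_def distinct_tuples_eq_injections)
  have "weighted_term k (edges H) d \<Q> (\<lambda>Q. indicator (G Q)) v
      = indicator (ordered_edges k H \<inter> ?K) v - d * indicator ?K v" if v: "v \<in> ?I" for v
  proof -
    have "(\<Prod>Q\<in>\<Q>. indicator (G Q) (restrict v Q)) = (indicator ?K v :: real)"
    proof (cases "\<forall>Q\<in>\<Q>. restrict v Q \<in> G Q")
      case True
      then show ?thesis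
        using v by (auto simp: supported_tuples_def distinct_tuples_eq_injections)
    next
      case False
      then obtain Q where "Q \<in> \<Q>" "restrict v Q \<notin> G Q" by blast
      then have "(\<Prod>Q\<in>\<Q>. indicator (G Q) (restrict v Q)) = (0 :: real)"
        by (intro prod_zero finite_index_family[OF \<Q>]) (auto simp: indicator_def)
      with False show ?thesis by (auto simp: supported_tuples_def)
    qed
    moreover have "v \<in> tuples (verts H) {1..k}"
      using v by (simp add: injections_def tuples_def)
    ultimately show ?thesis
      by (simp add: weighted_term_def indicator_inter_arith left_diff_distrib
          indicator_ordered_edges[OF H])
  qed
  then have "(\<Sum>v\<in>?I. weighted_term k (edges H) d \<Q> (\<lambda>Q. indicator (G Q)) v)
      = (\<Sum>v\<in>?I. indicator (ordered_edges k H \<inter> ?K) v) - d * (\<Sum>v\<in>?I. indicator ?K v)"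
    unfolding sum_distrib_left sum_subtractf[symmetric] by (rule sum.cong[OF refl])
  moreover have count: "(\<Sum>v\<in>?I. indicator S v) = real (card S)" if "S \<subseteq> ?I" for S
    using fin that by (simp add: indicator_def inf.absorb2)
  moreover have "(\<Sum>v\<in>?I. indicator ?K v) = real (card ?K)"
    "(\<Sum>v\<in>?I. indicator (ordered_edges k H \<inter> ?K) v) = real (card (ordered_edges k H \<inter> ?K))"
    by (intro count; use K in blast)+
  ultimately show ?thesis by simp
qed

section \<open>Discrepancy and weighted discrepancy of a single hypergraph\<close>

context
  fixes k :: nat and \<Q> :: "nat set set" and d :: real and H :: "'a hypergraph"
  assumes \<Q>: "\<Q> \<subseteq> Pow {1..k}" and d: "d \<in> {0..1}" and H: "uniform k H"
    and nonempty: "verts H \<noteq> {}"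
begin

lemma finite_verts: "finite (verts H)"
  using H by (simp add: uniform_def)

lemma card_verts_pos: "real (card (verts H)) ^ k > 0"
  using finite_verts nonempty by (simp add: card_gt_0_iff)

lemma weighted_avg_injections_approx:
  assumes "\<And>Q u. \<bar>w Q u\<bar> \<le> 1"
  shows "\<bar>avg {1..k} (verts H) (weighted_term k (edges H) d \<Q> w)
      - (\<Sum>v\<in>injections {1..k} (verts H). weighted_term k (edges H) d \<Q> w v) / real (card (verts H)) ^ k\<bar>
    \<le> real (k\<^sup>2) / real (card (verts H))"
  using avg_injections_approx[of "{1..k}" "verts H" "weighted_term k (edges H) d \<Q> w"]
    finite_verts nonempty abs_weighted_term_le_1[of d w, OF d assms] by simp

lemma DISC_if_avg_disc:
  assumes "avg_disc k \<Q> d \<epsilon> H"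
  shows "DISC k \<Q> d (\<epsilon> + real (k\<^sup>2) / real (card (verts H))) H"
  unfolding DISC_def
proof (intro allI impI)
  fix G assume "directed_family \<Q> (verts H) G"
  let ?w = "\<lambda>Q. indicator (G Q) :: (nat \<Rightarrow> 'a) \<Rightarrow> real"
  let ?S = "\<Sum>v\<in>injections {1..k} (verts H). weighted_term k (edges H) d \<Q> ?w v"
  have "\<bar>?w Q u\<bar> \<le> 1" for Q u by (simp add: indicator_def)
  note weighted_avg_injections_approx[of ?w, OF this] avg_discD[of k \<Q> d \<epsilon> H ?w, OF assms this]
  then have "\<bar>?S / real (card (verts H)) ^ k\<bar> \<le> \<epsilon> + real (k\<^sup>2) / real (card (verts H))"
    by linarith
  then have "\<bar>?S\<bar> \<le> (\<epsilon> + real (k\<^sup>2) / real (card (verts H))) * real (card (verts H)) ^ k"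
    using card_verts_pos by (simp add: divide_le_eq)
  then show "\<bar>real (card (ordered_edges k H \<inter> supported_tuples k \<Q> (verts H) G))
      - d * real (card (supported_tuples k \<Q> (verts H) G))\<bar>
    \<le> (\<epsilon> + real (k\<^sup>2) / real (card (verts H))) * real (card (verts H)) ^ k"
    by (simp only: disc_sum[OF \<Q> H])
qed

lemma avg_disc_if_DISC:
  assumes "DISC k \<Q> d \<epsilon> H"
  shows "avg_disc k \<Q> d (2 ^ card \<Q> * (\<epsilon> + real (k\<^sup>2) / real (card (verts H)))) H"
proof -
  let ?n = "real (card (verts H))"
  have zero_one: "\<bar>avg {1..k} (verts H) (weighted_term k (edges H) d \<Q> w)\<bar> \<le> \<epsilon> + real (k\<^sup>2) / ?n"
    if w: "\<And>Q u. w Q u \<in> {0, 1}" for w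
  proof -
    define G where "G = (\<lambda>Q. {u \<in> tuples (verts H) Q. w Q u = 1})"
    have "weighted_term k (edges H) d \<Q> (\<lambda>Q. indicator (G Q)) v = weighted_term k (edges H) d \<Q> w v"
      if v: "v \<in> injections {1..k} (verts H)" for v
    proof -
      have "indicator (G Q) (restrict v Q) = w Q (restrict v Q)" if "Q \<in> \<Q>" for Q
      proof -
        have "restrict v Q \<in> tuples (verts H) Q"
          using v that \<Q> by (auto simp: tuples_def injections_def)
        then show ?thesis using w[of Q "restrict v Q"] by (auto simp: G_def indicator_def)
      qed
      then show ?thesis by (simp add: weighted_term_def)
    qed
    then have "(\<Sum>v\<in>injections {1..k} (verts H). weighted_term k (edges H) d \<Q> w v)
        = real (card (ordered_edges k H \<inter> supported_tuples k \<Q> (verts H) G))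
          - d * real (card (supported_tuples k \<Q> (verts H) G))"
      by (subst disc_sum[OF \<Q> H, symmetric]) (simp cong: sum.cong)
    moreover have "directed_family \<Q> (verts H) G"
      by (auto simp: directed_family_def G_def)
    ultimately have "\<bar>(\<Sum>v\<in>injections {1..k} (verts H). weighted_term k (edges H) d \<Q> w v) / ?n ^ k\<bar> \<le> \<epsilon>"
      using assms card_verts_pos by (simp add: DISC_def divide_le_eq)
    moreover have "\<bar>w Q u\<bar> \<le> 1" for Q u using w[of Q u] by auto
    note weighted_avg_injections_approx[of w, OF this]
    ultimately show ?thesis
      by linarith
  qed
  show ?thesis
    unfolding avg_disc_def
  proof (intro allI impI)
    fix w :: "nat set \<Rightarrow> (nat \<Rightarrow> 'a) \<Rightarrow> real" assume w: "\<forall>Q u. \<bar>w Q u\<bar> \<le> 1"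
    \<comment> \<open>Edge indicator, density and normalisation together form the coefficients of a
      multilinear form in the weights.\<close>
    have avg: "avg {1..k} (verts H) (weighted_term k (edges H) d \<Q> w')
      = (\<Sum>v\<in>{1..k} \<rightarrow>\<^sub>E verts H. ((indicator (edges H) (v ` {1..k}) - d) / ?n ^ k)
          * (\<Prod>Q\<in>\<Q>. w' Q (restrict v Q)))" for w'
      by (simp add: avg_def weighted_term_def sum_divide_distrib)
    show "\<bar>avg {1..k} (verts H) (weighted_term k (edges H) d \<Q> w)\<bar>
        \<le> 2 ^ card \<Q> * (\<epsilon> + real (k\<^sup>2) / ?n)"
      unfolding avg
    proof (rule multilinear_weight_bound[where r = "\<lambda>Q v. restrict v Q"])
      show "finite \<Q>" by (rule finite_index_family[OF \<Q>])
      show "finite ({1..k} \<rightarrow>\<^sub>E verts H)" using finite_verts by (simp add: finite_PiE)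
    qed (use w zero_one[unfolded avg] in simp_all)
  qed
qed

text \<open>The convention on repeated entries becomes part of the weight. Both sides range over all
  tuples, so there is no error term. Cutting the weight off outside \<open>\<Q>\<close> and outside
  the tuples over \<open>V\<close> yields the global bound that \<open>avg_disc\<close>
  demands.\<close>

lemma wdisc_sum:
  "(\<Sum>v\<in>tuples (verts H) {1..k}. (indicator (ordered_edges k H) v - d)
      * (\<Prod>Q\<in>\<Q>. if inj_on v Q then w Q (restrict v Q) else 0))
    = avg {1..k} (verts H) (weighted_term k (edges H) d \<Q>
        (\<lambda>Q u. if Q \<in> \<Q> \<and> u \<in> tuples (verts H) Q \<and> inj_on u Q then w Q u else 0))
      * real (card (verts H)) ^ k"
proof -
  have "(if inj_on v Q then w Q (restrict v Q) else 0) =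
      (if Q \<in> \<Q> \<and> restrict v Q \<in> tuples (verts H) Q \<and> inj_on (restrict v Q) Q
       then w Q (restrict v Q) else 0)"
    if "v \<in> tuples (verts H) {1..k}" "Q \<in> \<Q>" for v Q
    using that \<Q> by (auto simp: tuples_def)
  then have "(indicator (ordered_edges k H) v - d) * (\<Prod>Q\<in>\<Q>. if inj_on v Q then w Q (restrict v Q) else 0)
      = weighted_term k (edges H) d \<Q>
        (\<lambda>Q u. if Q \<in> \<Q> \<and> u \<in> tuples (verts H) Q \<and> inj_on u Q then w Q u else 0) v"
    if "v \<in> tuples (verts H) {1..k}" for v
    using that unfolding weighted_term_def indicator_ordered_edges[OF H that]
    by (intro arg_cong2[where f = "(*)"] prod.cong) auto
  then show ?thesis
    using card_verts_pos by (simp add: avg_def tuples_def)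
qed

lemma WDISC_if_avg_disc:
  assumes "avg_disc k \<Q> d \<epsilon> H"
  shows "WDISC k \<Q> d \<epsilon> H"
  unfolding WDISC_def
proof (intro allI impI)
  fix w :: "nat set \<Rightarrow> (nat \<Rightarrow> 'a) \<Rightarrow> real"
  assume w: "\<forall>Q\<in>\<Q>. \<forall>u\<in>tuples (verts H) Q. w Q u \<in> {-1..1}"
  let ?w = "\<lambda>Q u. if Q \<in> \<Q> \<and> u \<in> tuples (verts H) Q \<and> inj_on u Q then w Q u else 0"
  have "\<bar>?w Q u\<bar> \<le> 1" for Q u using w by (auto simp: abs_le_iff minus_le_iff)
  note avg_discD[of k \<Q> d \<epsilon> H ?w, OF assms this]
  then show "\<bar>\<Sum>v\<in>tuples (verts H) {1..k}. (indicator (ordered_edges k H) v - d)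
      * (\<Prod>Q\<in>\<Q>. if inj_on v Q then w Q (restrict v Q) else 0)\<bar> \<le> \<epsilon> * real (card (verts H)) ^ k"
    unfolding wdisc_sum using card_verts_pos by (simp add: abs_mult mult_right_mono)
qed

text \<open>A weight and its truncation agree on injections. Passing to injections and back costs
  \<open>k\<^sup>2 / n\<close> each way, hence the factor 2.\<close>

lemma avg_disc_if_WDISC:
  assumes "WDISC k \<Q> d \<epsilon> H"
  shows "avg_disc k \<Q> d (\<epsilon> + 2 * real (k\<^sup>2) / real (card (verts H))) H"
  unfolding avg_disc_def
proof (intro allI impI)
  fix w :: "nat set \<Rightarrow> (nat \<Rightarrow> 'a) \<Rightarrow> real" assume w: "\<forall>Q u. \<bar>w Q u\<bar> \<le> 1"
  let ?w = "\<lambda>Q u. if Q \<in> \<Q> \<and> u \<in> tuples (verts H) Q \<and> inj_on u Q then w Q u else 0"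
  have "\<forall>Q\<in>\<Q>. \<forall>u\<in>tuples (verts H) Q. w Q u \<in> {-1..1}"
    using w by (simp add: abs_le_iff minus_le_iff)
  then have "\<bar>avg {1..k} (verts H) (weighted_term k (edges H) d \<Q> ?w) * real (card (verts H)) ^ k\<bar>
      \<le> \<epsilon> * real (card (verts H)) ^ k"
    using assms unfolding WDISC_def wdisc_sum by blast
  then have "\<bar>avg {1..k} (verts H) (weighted_term k (edges H) d \<Q> ?w)\<bar> \<le> \<epsilon>"
    using card_verts_pos by (simp add: abs_mult)
  moreover have "weighted_term k (edges H) d \<Q> ?w v = weighted_term k (edges H) d \<Q> w v"
    if v: "v \<in> injections {1..k} (verts H)" for v
  proof -
    have "restrict v Q \<in> tuples (verts H) Q \<and> inj_on v Q" if "Q \<in> \<Q>" for Q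
      using v that \<Q> by (auto simp: tuples_def injections_def intro: inj_on_subset)
    then show ?thesis by (simp add: weighted_term_def)
  qed
  then have "(\<Sum>v\<in>injections {1..k} (verts H). weighted_term k (edges H) d \<Q> ?w v)
      = (\<Sum>v\<in>injections {1..k} (verts H). weighted_term k (edges H) d \<Q> w v)"
    by (rule sum.cong[OF refl])
  moreover have "\<bar>?w Q u\<bar> \<le> 1" for Q u using w by simp
  ultimately show "\<bar>avg {1..k} (verts H) (weighted_term k (edges H) d \<Q> w)\<bar>
      \<le> \<epsilon> + 2 * real (k\<^sup>2) / real (card (verts H))"
    using weighted_avg_injections_approx[of ?w] weighted_avg_injections_approx[of w] w by simp
qed

end

subsection \<open>Counting\<close>

definition hom_density :: "'b hypergraph \<Rightarrow> 'a hypergraph \<Rightarrow> real" where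
  "hom_density F H = avg (verts F) (verts H) (\<lambda>\<phi>. \<Prod>f\<in>edges F. indicator (edges H) (\<phi> ` f))"

lemma uniform_finite_edges: "uniform k F \<Longrightarrow> finite (edges F)"
  by (rule finite_subset[of _ "Pow (verts F)"]) (auto simp: uniform_def)

lemma labeled_copies_approx:
  assumes F: "uniform k F" and V: "finite (verts H)" "verts H \<noteq> {}"
  shows "\<bar>hom_density F H - real (card (labeled_copies F H)) / real (card (verts H)) ^ card (verts F)\<bar>
    \<le> real ((card (verts F))\<^sup>2) / real (card (verts H))"
proof -
  let ?I = "injections (verts F) (verts H)"
  have fin: "finite (verts F)" "finite (edges F)"
    using F uniform_finite_edges[OF F] by (simp_all add: uniform_def)
  have "finite ?I"
    using fin V by (simp add: injections_def finite_PiE)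
  moreover have "(\<Prod>f\<in>edges F. indicator (edges H) (\<phi> ` f) :: real)
      = of_bool (\<forall>f\<in>edges F. \<phi> ` f \<in> edges H)" for \<phi>
    using fin by (auto simp: indicator_def)
  moreover have "?I \<inter> {\<phi>. \<forall>f\<in>edges F. \<phi> ` f \<in> edges H} = labeled_copies F H"
    by (auto simp: labeled_copies_def)
  ultimately have "(\<Sum>\<phi>\<in>?I. \<Prod>f\<in>edges F. indicator (edges H) (\<phi> ` f)) = real (card (labeled_copies F H))"
    by simp
  moreover have "\<bar>\<Prod>f\<in>edges F. indicator (edges H) (\<phi> ` f)\<bar> \<le> (1 :: real)" for \<phi>
    by (rule abs_prod_le_1) (simp add: indicator_def)
  note avg_injections_approx[where f = "\<lambda>\<phi>. \<Prod>f\<in>edges F. indicator (edges H) (\<phi> ` f)",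
      OF fin(1) V this]
  ultimately show ?thesis by (simp add: hom_density_def)
qed

lemma CL_iff:
  assumes "finite (verts H)" "verts H \<noteq> {}"
  shows "CL d F \<epsilon> H \<longleftrightarrow>
    \<bar>real (card (labeled_copies F H)) / real (card (verts H)) ^ card (verts F) - d ^ card (edges F)\<bar> \<le> \<epsilon>"
proof -
  let ?N = "real (card (verts H)) ^ card (verts F)"
  have N: "?N > 0" using assms by (simp add: card_gt_0_iff)
  then have "real (card (labeled_copies F H)) / ?N - d ^ card (edges F)
      = (real (card (labeled_copies F H)) - d ^ card (edges F) * ?N) / ?N"
    by (simp add: field_simps)
  then show ?thesis using N by (simp add: CL_def divide_le_eq)
qed

text \<open>In the product over the earlier edges, each factor depends, once the vertices outside \<open>e\<close>
  are fixed, only on a subtuple indexed by some member of \<open>\<Q>\<close>, so it can be absorbed in a weight.\<close>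

lemma avg_disc_edge:
  fixes f :: "nat \<Rightarrow> 'b set" and H :: "'a hypergraph"
  assumes \<Q>: "\<Q> \<subseteq> Pow {1..k}" and V: "finite (verts H)" "verts H \<noteq> {}"
    and disc: "avg_disc k \<Q> d \<delta> H"
    and X: "finite X" and x: "bij_betw x {1..k} e" and sub: "e \<subseteq> X" "\<And>h. h < j \<Longrightarrow> f h \<subseteq> X"
    and q: "\<And>h. h < j \<Longrightarrow> q h \<in> \<Q>" "\<And>h. h < j \<Longrightarrow> {r \<in> {1..k}. x r \<in> f h \<inter> e} \<subseteq> q h"
  shows "\<bar>avg X (verts H) (\<lambda>\<phi>. (indicator (edges H) (\<phi> ` e) - d)
      * (\<Prod>h<j. indicator (edges H) (\<phi> ` f h)))\<bar> \<le> \<delta>"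
proof -
  let ?V = "verts H" and ?g = "\<lambda>\<phi>. (indicator (edges H) (\<phi> ` e) - d)
      * (\<Prod>h<j. indicator (edges H) (\<phi> ` f h)) :: real"
  let ?inv = "the_inv_into {1..k} x"
  have fin: "finite (X - e)" "finite e" using X sub(1) by (auto intro: finite_subset)
  have X_eq: "X = (X - e) \<union> e" using sub(1) by blast
  have e: "e = x ` {1..k}" and inj: "inj_on x {1..k}" using x by (auto simp: bij_betw_def)
  have "finite \<Q>" using \<Q> by (rule finite_index_family)
  have inner: "\<bar>avg e ?V (\<lambda>\<beta>. ?g (override_on \<beta> \<alpha> (X - e)))\<bar> \<le> \<delta>" for \<alpha>
  proof -
    \<comment> \<open>Several earlier edges may have been assigned the same member of
      \<open>\<Q>\<close>, so the weight at \<open>Q\<close> multiplies all of them; it is 1 where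
      none was assigned. The map \<open>?inv\<close> recovers the coordinate of a vertex of
      \<open>e\<close>.\<close>
    define w where "w = (\<lambda>Q u. \<Prod>h\<in>{h\<in>{..<j}. q h = Q}.
      indicator (edges H) ((\<lambda>y. if y \<in> X - e then \<alpha> y else u (?inv y)) ` f h) :: real)"
    have "?g (override_on \<beta> \<alpha> (X - e)) = weighted_term k (edges H) d \<Q> w (\<beta> \<circ> x)" for \<beta>
    proof -
      have img: "override_on \<beta> \<alpha> (X - e) ` f h
          = (\<lambda>y. if y \<in> X - e then \<alpha> y else restrict (\<beta> \<circ> x) (q h) (?inv y)) ` f h" if h: "h < j" for h
      proof (rule image_cong[OF refl])
        fix y assume y: "y \<in> f h"
        show "override_on \<beta> \<alpha> (X - e) y
            = (if y \<in> X - e then \<alpha> y else restrict (\<beta> \<circ> x) (q h) (?inv y))"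
        proof (cases "y \<in> e")
          case True
          then obtain r where r: "r \<in> {1..k}" "y = x r" using e by blast
          \<comment> \<open>Simplicity enters here: the coordinate of a shared vertex lies in
            \<open>q h\<close>, so restricting to \<open>q h\<close> keeps its value.\<close>
          then have "r \<in> q h" using q(2)[OF h] y True by blast
          with r True inj show ?thesis
            by (auto simp: the_inv_into_f_f)
        next
          case False
          then show ?thesis using sub(2)[OF h] y by auto
        qed
      qed
      have "(\<Prod>h<j. indicator (edges H) (override_on \<beta> \<alpha> (X - e) ` f h) :: real)
        = (\<Prod>Q\<in>\<Q>. \<Prod>h\<in>{h\<in>{..<j}. q h = Q}. indicator (edges H) (override_on \<beta> \<alpha> (X - e) ` f h))"
        using \<open>finite \<Q>\<close> q(1) by (intro prod.group[symmetric]) auto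
      also have "\<dots> = (\<Prod>Q\<in>\<Q>. w Q (restrict (\<beta> \<circ> x) Q))"
        unfolding w_def by (intro prod.cong refl) (auto simp: img)
      finally have "(\<Prod>h<j. indicator (edges H) (override_on \<beta> \<alpha> (X - e) ` f h) :: real)
        = (\<Prod>Q\<in>\<Q>. w Q (restrict (\<beta> \<circ> x) Q))" .
      moreover have "override_on \<beta> \<alpha> (X - e) ` e = (\<beta> \<circ> x) ` {1..k}"
        unfolding e by (auto simp: override_on_def)
      ultimately show ?thesis by (simp only: weighted_term_def)
    qed
    then have "avg e ?V (\<lambda>\<beta>. ?g (override_on \<beta> \<alpha> (X - e)))
        = avg (x ` {1..k}) ?V (\<lambda>\<beta>. weighted_term k (edges H) d \<Q> w (\<beta> \<circ> x))"
      by (simp add: e)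
    also have "\<dots> = avg {1..k} ?V (weighted_term k (edges H) d \<Q> w)"
      by (rule avg_reindex_depends_on[OF inj weighted_term_depends_on[OF \<Q>]])
    finally show ?thesis
      using avg_discD[of k \<Q> d \<delta> H w, OF disc]
      by (simp add: w_def abs_prod_le_1 indicator_def)
  qed
  have "avg X ?V ?g = avg (X - e) ?V (\<lambda>\<alpha>. avg e ?V (\<lambda>\<beta>. ?g (override_on \<beta> \<alpha> (X - e))))"
    by (subst X_eq, rule avg_Un) (use fin in auto)
  then show ?thesis using abs_avg_le[OF fin(1) V inner] by simp
qed

text \<open>Telescoping along the simple order: by \<open>avg_disc_edge\<close> each new edge acts
  as the factor \<open>d\<close> up to \<open>\<delta>\<close>, and multiplying by
  \<open>d \<le> 1\<close> does not enlarge the error already accumulated.\<close>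

lemma hom_density_approx_if_avg_disc:
  fixes F :: "'b hypergraph" and H :: "'a hypergraph"
  assumes \<Q>: "\<Q> \<subseteq> Pow {1..k}" and d: "d \<in> {0..1}" and V: "finite (verts H)" "verts H \<noteq> {}"
    and disc: "avg_disc k \<Q> d \<delta> H" and F: "simple k \<Q> F"
  shows "\<bar>hom_density F H - d ^ card (edges F)\<bar> \<le> real (card (edges F)) * \<delta>"
proof -
  obtain f :: "'b set list" and x :: "nat \<Rightarrow> nat \<Rightarrow> 'b" where
    f: "distinct f" "set f = edges F" and x: "\<And>i. i < length f \<Longrightarrow> bij_betw (x i) {1..k} (f ! i)" and
    meet: "\<forall>i<length f. \<forall>h<i. \<exists>Q\<in>\<Q>. {r \<in> {1..k}. x i r \<in> f ! h \<inter> f ! i} \<subseteq> Q"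
    using F unfolding simple_def by blast
  let ?p = "\<lambda>j \<phi>. \<Prod>h<j. indicator (edges H) (\<phi> ` (f ! h)) :: real"
  have sub: "f ! i \<subseteq> verts F" if "i < length f" for i
    using F nth_mem[OF that] f by (auto simp: simple_def uniform_def)
  have finX: "finite (verts F)" using F by (simp add: simple_def uniform_def)
  have "\<bar>avg (verts F) (verts H) (?p j) - d ^ j\<bar> \<le> real j * \<delta>" if "j \<le> length f" for j
    using that
  proof (induction j)
    case 0
    then show ?case using finX V by (simp add: avg_const)
  next
    case (Suc j)
    obtain q where q: "\<And>h. h < j \<Longrightarrow> q h \<in> \<Q> \<and> {r \<in> {1..k}. x j r \<in> f ! h \<inter> f ! j} \<subseteq> q h"
      using meet Suc.prems by (metis Suc_le_lessD)
    have "\<bar>avg (verts F) (verts H) (\<lambda>\<phi>. (indicator (edges H) (\<phi> ` (f ! j)) - d) * ?p j \<phi>)\<bar> \<le> \<delta>"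
      by (rule avg_disc_edge[OF \<Q> V disc finX x, where q = q]) (use Suc.prems sub q in auto)
    moreover have "avg (verts F) (verts H) (\<lambda>\<phi>. (indicator (edges H) (\<phi> ` (f ! j)) - d) * ?p j \<phi>)
        = avg (verts F) (verts H) (?p (Suc j)) - d * avg (verts F) (verts H) (?p j)"
      by (simp add: left_diff_distrib avg_diff avg_cmult mult.commute)
    moreover have "\<bar>d * avg (verts F) (verts H) (?p j) - d ^ Suc j\<bar> \<le> real j * \<delta>"
    proof -
      have "\<bar>d * avg (verts F) (verts H) (?p j) - d ^ Suc j\<bar>
          = d * \<bar>avg (verts F) (verts H) (?p j) - d ^ j\<bar>"
        using d by (simp add: abs_mult flip: right_diff_distrib)
      also have "\<dots> \<le> 1 * (real j * \<delta>)"
        using d Suc by (intro mult_mono) auto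
      finally show ?thesis by simp
    qed
    ultimately show ?case by (simp add: algebra_simps)
  qed
  from this[of "length f"]
  have "\<bar>avg (verts F) (verts H) (?p (length f)) - d ^ card (edges F)\<bar> \<le> real (card (edges F)) * \<delta>"
    using f distinct_card by fastforce
  moreover have "?p (length f) = (\<lambda>\<phi>. \<Prod>g\<in>edges F. indicator (edges H) (\<phi> ` g))"
  proof
    fix \<phi> :: "'b \<Rightarrow> 'a"
    have "bij_betw ((!) f) {..<length f} (edges F)"
      using f by (intro bij_betw_nth) auto
    then show "?p (length f) \<phi> = (\<Prod>g\<in>edges F. indicator (edges H) (\<phi> ` g))"
      by (rule prod.reindex_bij_betw)
  qed
  ultimately show ?thesis by (simp add: hom_density_def)
qed

section \<open>Relabelling the vertices of the counted hypergraph\<close>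

text \<open>Injectivity on vertices carries over to edges, so no two factors of the product
  merge.\<close>

lemma hom_density_image:
  fixes F :: "'b hypergraph" and h :: "'b \<Rightarrow> 'c"
  assumes F: "uniform k F" and h: "inj_on h (verts F)"
  shows "hom_density (h ` verts F, (`) h ` edges F) H = hom_density F H"
proof -
  have sub: "f \<subseteq> verts F" if "f \<in> edges F" for f using F that by (auto simp: uniform_def)
  have "inj_on ((`) h) (edges F)"
    using sub h by (meson inj_on_image_Pow inj_on_subset PowI subsetI)
  then have "hom_density (h ` verts F, (`) h ` edges F) H
      = avg (h ` verts F) (verts H) (\<lambda>\<phi>. \<Prod>f\<in>edges F. indicator (edges H) ((\<phi> \<circ> h) ` f))"
    by (simp add: hom_density_def prod.reindex image_comp)
  also have "\<dots> = hom_density F H"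
    unfolding hom_density_def
  proof (rule avg_reindex_depends_on[OF h])
    show "depends_on (verts F) (\<lambda>\<phi>. \<Prod>f\<in>edges F. indicator (edges H) (\<phi> ` f))"
      unfolding depends_on_def using sub
      by (auto intro!: prod.cong arg_cong[where f = "indicator (edges H)"] image_cong)
  qed
  finally show ?thesis .
qed

lemma simple_image:
  fixes F :: "'b hypergraph" and h :: "'b \<Rightarrow> 'c"
  assumes F: "simple k \<Q> F" and h: "inj_on h (verts F)"
  shows "simple k \<Q> (h ` verts F, (`) h ` edges F)"
proof -
  obtain f :: "'b set list" and x :: "nat \<Rightarrow> nat \<Rightarrow> 'b" where
    f: "distinct f" "set f = edges F" and x: "\<And>i. i < length f \<Longrightarrow> bij_betw (x i) {1..k} (f ! i)" and
    meet: "\<forall>i<length f. \<forall>h<i. \<exists>Q\<in>\<Q>. {r \<in> {1..k}. x i r \<in> f ! h \<inter> f ! i} \<subseteq> Q"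
    using F unfolding simple_def by blast
  have U: "uniform k F" using F by (simp add: simple_def)
  have sub: "f ! i \<subseteq> verts F" if "i < length f" for i
    using U nth_mem[OF that] f by (auto simp: uniform_def)
  have sub': "g \<subseteq> verts F" if "g \<in> edges F" for g using U that by (auto simp: uniform_def)
  have inj: "inj_on ((`) h) (edges F)"
    using sub' h by (meson inj_on_image_Pow inj_on_subset PowI subsetI)
  have "uniform k (h ` verts F, (`) h ` edges F)"
    using U sub' h by (auto simp: uniform_def card_image inj_on_subset)
  moreover have "distinct (map ((`) h) f)" using f inj by (simp add: distinct_map)
  moreover have "bij_betw (h \<circ> x i) {1..k} (map ((`) h) f ! i)" if i: "i < length f" for i
    using bij_betw_trans[OF x[OF i] inj_on_imp_bij_betw[OF inj_on_subset[OF h sub[OF i]]]] i by simp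
  moreover have "\<exists>Q\<in>\<Q>. {r \<in> {1..k}. (h \<circ> x i) r \<in> map ((`) h) f ! j \<inter> map ((`) h) f ! i} \<subseteq> Q"
    if i: "i < length f" "j < i" for i j
  proof -
    have "x i r \<in> f ! j" if r: "r \<in> {1..k}" "h (x i r) \<in> h ` (f ! j)" for r
    proof -
      have "x i r \<in> verts F" using x[OF i(1)] sub[OF i(1)] r by (auto simp: bij_betw_def)
      moreover have "f ! j \<subseteq> verts F" using sub[of j] i by simp
      ultimately show ?thesis using r h by (meson inj_on_image_mem_iff)
    qed
    moreover have "x i r \<in> f ! i" if "r \<in> {1..k}" for r
      using x[OF i(1)] that by (auto simp: bij_betw_def)
    ultimately have "{r \<in> {1..k}. (h \<circ> x i) r \<in> map ((`) h) f ! j \<inter> map ((`) h) f ! i}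
        \<subseteq> {r \<in> {1..k}. x i r \<in> f ! j \<inter> f ! i}"
      using i by auto
    then show ?thesis using meet i by (meson order_trans)
  qed
  ultimately show ?thesis
    unfolding simple_def using f
    by (intro conjI exI[of _ "map ((`) h) f"] exI[of _ "\<lambda>i. h \<circ> x i"]) simp_all
qed

subsection \<open>Iterated doublings\<close>

definition bit_vectors :: "nat \<Rightarrow> bool list set" where
  "bit_vectors m = {bs. length bs = m}"

text \<open>The edges of an iterated doubling correspond to bit vectors; \<open>vtx Qs bs i\<close> is the vertex in
  class \<open>i\<close> of the edge \<open>bs\<close>.\<close>

fun vtx :: "nat set list \<Rightarrow> bool list \<Rightarrow> nat \<Rightarrow> dvertex" where
  "vtx (Q # Qs) (b # bs) i = (if i \<in> Q then vtx Qs bs i else Copy (vtx Qs bs i) b)"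
| "vtx _ _ i = Orig i"

text \<open>A general index set \<open>I\<close> is allowed because a doubling separates the classes
  in \<open>Q\<close>, which are shared, from the others, which are copied.\<close>

definition vtxs :: "nat set list \<Rightarrow> nat set \<Rightarrow> dvertex set" where
  "vtxs Qs I = {vtx Qs bs i | bs i. bs \<in> bit_vectors (length Qs) \<and> i \<in> I}"

lemma bit_vectors_0: "bit_vectors 0 = {[]}"
  by (auto simp: bit_vectors_def)

lemma bit_vectors_Suc: "bit_vectors (Suc m) = (#) True ` bit_vectors m \<union> (#) False ` bit_vectors m"
  by (auto simp: bit_vectors_def length_Suc_conv image_iff)

lemma finite_bit_vectors: "finite (bit_vectors m)"
  by (induction m) (simp_all add: bit_vectors_0 bit_vectors_Suc)

lemma prod_bit_vectors_Suc:
  "(\<Prod>bs\<in>bit_vectors (Suc m). f bs)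
    = (\<Prod>bs\<in>bit_vectors m. f (True # bs)) * (\<Prod>bs\<in>bit_vectors m. f (False # bs))"
  unfolding bit_vectors_Suc
  by (subst prod.union_disjoint) (auto simp: finite_bit_vectors prod.reindex)

text \<open>Copying never changes the class of a vertex; this invariant separates the
  classes.\<close>

fun root :: "dvertex \<Rightarrow> nat" where
  "root (Orig i) = i"
| "root (Copy x b) = root x"

lemma root_vtx: "root (vtx Qs bs i) = i"
  by (induction Qs bs i rule: vtx.induct) auto

lemma vtx_eq_imp_index_eq: "vtx Qs bs i = vtx Qs bs' i' \<Longrightarrow> i = i'"
  by (metis root_vtx)

text \<open>A vertex whose class lies outside \<open>Qs ! j\<close> carries bit \<open>j\<close> as
  a \<open>Copy\<close> label. Read contrapositively, edges that differ in bit \<open>j\<close> meet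
  only in classes of \<open>Qs ! j\<close>; both simplicity and distinctness of the edges rest on
  this.\<close>

lemma vtx_eqD:
  assumes "vtx Qs bs i = vtx Qs bs' i" "length bs = length Qs" "length bs' = length Qs"
    and "j < length Qs" "i \<notin> Qs ! j"
  shows "bs ! j = bs' ! j"
  using assms
proof (induction Qs arbitrary: bs bs' j)
  case (Cons Q Qs)
  obtain b cs b' cs' where "bs = b # cs" "bs' = b' # cs'"
    using Cons.prems(2,3) by (metis length_Suc_conv)
  then show ?case
    using Cons.IH[of cs cs' "j - 1"] Cons.prems by (cases j) (auto split: if_splits)
qed simp

lemma finite_vtxs: "finite I \<Longrightarrow> finite (vtxs Qs I)"
  unfolding vtxs_def using finite_bit_vectors by (intro finite_image_set2) simp_all

lemma vtx_in_vtxs: "bs \<in> bit_vectors (length Qs) \<Longrightarrow> i \<in> I \<Longrightarrow> vtx Qs bs i \<in> vtxs Qs I"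
  unfolding vtxs_def by blast

lemma vtxsE:
  assumes "x \<in> vtxs Qs I"
  obtains bs i where "x = vtx Qs bs i" "bs \<in> bit_vectors (length Qs)" "i \<in> I"
  using assms unfolding vtxs_def by blast

lemma vtxs_Un: "vtxs Qs (I \<union> J) = vtxs Qs I \<union> vtxs Qs J"
  by (auto simp: vtxs_def)

lemma vtxs_disjoint: "I \<inter> J = {} \<Longrightarrow> vtxs Qs I \<inter> vtxs Qs J = {}"
  by (auto simp: vtxs_def dest!: vtx_eq_imp_index_eq)

text \<open>The domain on the right of \<open>avg_doubling\<close>: shared vertices and two copies
  of the rest.\<close>

lemma vtxs_Cons:
  "vtxs (Q # Qs) I = vtxs Qs (I \<inter> Q)
    \<union> ((\<lambda>x. Copy x True) ` vtxs Qs (I - Q) \<union> (\<lambda>x. Copy x False) ` vtxs Qs (I - Q))" (is "?L = ?R")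
proof
  show "?L \<subseteq> ?R"
  proof
    fix y assume "y \<in> ?L"
    then obtain b bs i where "y = vtx (Q # Qs) (b # bs) i" "bs \<in> bit_vectors (length Qs)" "i \<in> I"
      by (auto simp: vtxs_def bit_vectors_Suc)
    then show "y \<in> ?R" by (cases b) (auto simp: vtx_in_vtxs)
  qed
  have step: "vtx (Q # Qs) (b # bs) i \<in> ?L" if "bs \<in> bit_vectors (length Qs)" "i \<in> I" for b bs i
    using that by (intro vtx_in_vtxs) (simp_all add: bit_vectors_def)
  show "?R \<subseteq> ?L"
  proof
    fix y assume "y \<in> ?R"
    then obtain bs i b where "bs \<in> bit_vectors (length Qs)" "i \<in> I" "y = vtx (Q # Qs) (b # bs) i"
      by (auto elim!: vtxsE)
    then show "y \<in> ?L" using step by blast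
  qed
qed

text \<open>The head of the list is the doubling performed last, so the first bit of an edge names
  its copy in the outermost doubling.\<close>

lemma foldr_doubling:
  "foldr (doubling k) Qs (single_edge k)
    = ((\<lambda>i. vtxs Qs {i}), (\<lambda>bs. vtx Qs bs ` {1..k}) ` bit_vectors (length Qs))"
proof (induction Qs)
  case Nil
  show ?case by (auto simp: single_edge_def vtxs_def bit_vectors_0)
next
  case (Cons Q Qs)
  let ?F = "((\<lambda>i. vtxs Qs {i}), (\<lambda>bs. vtx Qs bs ` {1..k}) ` bit_vectors (length Qs))"
  have image: "x ` ({1..k} \<inter> Q) \<union> (\<lambda>r. Copy (x r) a) ` ({1..k} - Q) = vtx (Q # Qs) (a # bs) ` {1..k}"
    if "\<And>j. j \<in> {1..k} \<Longrightarrow> x j = vtx Qs bs j" for x a bs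
  proof -
    have "x ` ({1..k} \<inter> Q) = vtx (Q # Qs) (a # bs) ` ({1..k} \<inter> Q)"
      "(\<lambda>r. Copy (x r) a) ` ({1..k} - Q) = vtx (Q # Qs) (a # bs) ` ({1..k} - Q)"
      using that by (auto intro!: image_cong)
    then show ?thesis by (metis Int_Diff_Un image_Un)
  qed
  have "snd (doubling k Q ?F)
      = (\<lambda>bs. vtx (Q # Qs) bs ` {1..k}) ` bit_vectors (length (Q # Qs))" (is "?L = ?R")
  proof
    show "?L \<subseteq> ?R"
    proof
      fix e assume "e \<in> ?L"
      then obtain x a bs where e: "e = x ` ({1..k} \<inter> Q) \<union> (\<lambda>r. Copy (x r) a) ` ({1..k} - Q)"
        and x: "\<forall>j\<in>{1..k}. x j \<in> vtxs Qs {j}" "x ` {1..k} = vtx Qs bs ` {1..k}"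
        and bs: "bs \<in> bit_vectors (length Qs)"
        by (auto simp: doubling_def)
      \<comment> \<open>Classes are disjoint, so a choice of one vertex per class whose image is the
        edge \<open>bs\<close> must pick the vertices of that edge class by class.\<close>
      have "x j = vtx Qs bs j" if j: "j \<in> {1..k}" for j
      proof -
        obtain i where "x j = vtx Qs bs i" using x(2) j by (metis imageE imageI)
        moreover obtain cs where "x j = vtx Qs cs j" using x(1) j by (metis singletonD vtxsE)
        ultimately show ?thesis by (metis vtx_eq_imp_index_eq)
      qed
      from image[OF this, of a] have "e = vtx (Q # Qs) (a # bs) ` {1..k}" using e by simp
      moreover have "a # bs \<in> bit_vectors (length (Q # Qs))" using bs by (simp add: bit_vectors_def)
      ultimately show "e \<in> ?R" by blast
    qed
    show "?R \<subseteq> ?L"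
    proof
      fix e assume "e \<in> ?R"
      then obtain a bs where "e = vtx (Q # Qs) (a # bs) ` {1..k}" "bs \<in> bit_vectors (length Qs)"
        by (auto simp: bit_vectors_Suc)
      then have "e = vtx Qs bs ` ({1..k} \<inter> Q) \<union> (\<lambda>r. Copy (vtx Qs bs r) a) ` ({1..k} - Q)"
        "\<forall>j\<in>{1..k}. vtx Qs bs j \<in> vtxs Qs {j}"
        using image[of "vtx Qs bs" bs a] by (auto simp: vtx_in_vtxs)
      then show "e \<in> ?L"
        using \<open>bs \<in> bit_vectors (length Qs)\<close> unfolding doubling_def snd_conv fst_conv
        by (intro CollectI exI[of _ "vtx Qs bs"] exI[of _ a]) blast
    qed
  qed
  moreover have "fst (doubling k Q ?F) = (\<lambda>i. vtxs (Q # Qs) {i})"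
  proof
    fix i
    have "{Copy x a |x a. x \<in> vtxs Qs {i}}
        = (\<lambda>x. Copy x True) ` vtxs Qs {i} \<union> (\<lambda>x. Copy x False) ` vtxs Qs {i}"
      by (auto simp: image_iff)
    moreover have "vtxs Qs {} = {}" by (simp add: vtxs_def)
    ultimately show "fst (doubling k Q ?F) i = vtxs (Q # Qs) {i}"
      by (cases "i \<in> Q") (simp_all add: doubling_def vtxs_Cons insert_Diff_if)
  qed
  ultimately show ?case
    unfolding foldr.simps o_apply Cons.IH by (intro prod_eqI) simp_all
qed

text \<open>Eliminates the choice operator in \<open>M_partite\<close>; the later arguments work for
  whichever enumeration it picks.\<close>

lemma M_hypergraph_eq:
  assumes "finite \<Q>"
  obtains Qs where "distinct Qs" "set Qs = \<Q>"
    "M_hypergraph k \<Q> = (vtxs Qs {1..k}, (\<lambda>bs. vtx Qs bs ` {1..k}) ` bit_vectors (length Qs))"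
proof -
  define Qs where "Qs = (SOME Qs. distinct Qs \<and> set Qs = \<Q>)"
  have "distinct Qs \<and> set Qs = \<Q>"
    unfolding Qs_def using finite_distinct_list[OF assms] by (rule_tac someI_ex) blast
  moreover have "M_partite k \<Q> = ((\<lambda>i. vtxs Qs {i}), (\<lambda>bs. vtx Qs bs ` {1..k}) ` bit_vectors (length Qs))"
    unfolding M_partite_def Qs_def[symmetric] by (rule foldr_doubling)
  moreover have "(\<Union>i\<in>{1..k}. vtxs Qs {i}) = vtxs Qs {1..k}"
    unfolding vtxs_def by blast
  ultimately show thesis using that[of Qs] by (simp add: M_hypergraph_def)
qed

text \<open>Each \<open>Qs ! j\<close> misses some class \<open>i\<close>, and the vertex of an edge
  in class \<open>i\<close> reveals bit \<open>j\<close>. Products over edges thereby become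
  products over bit vectors.\<close>

lemma inj_on_edge:
  assumes "set Qs \<subseteq> Pow {1..k} - {{1..k}}"
  shows "inj_on (\<lambda>bs. vtx Qs bs ` {1..k}) (bit_vectors (length Qs))"
proof (rule inj_onI)
  fix bs bs' assume bs: "bs \<in> bit_vectors (length Qs)" "bs' \<in> bit_vectors (length Qs)"
    and eq: "vtx Qs bs ` {1..k} = vtx Qs bs' ` {1..k}"
  show "bs = bs'"
  proof (rule nth_equalityI)
    show "length bs = length bs'" using bs by (simp add: bit_vectors_def)
    fix j assume "j < length bs"
    then have j: "j < length Qs" using bs by (simp add: bit_vectors_def)
    then have "Qs ! j \<in> Pow {1..k} - {{1..k}}" using assms nth_mem by blast
    then obtain i where i: "i \<in> {1..k}" "i \<notin> Qs ! j" by blast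
    with eq have "vtx Qs bs i \<in> vtx Qs bs' ` {1..k}" by blast
    then have "vtx Qs bs i = vtx Qs bs' i" by (metis imageE vtx_eq_imp_index_eq)
    then show "bs ! j = bs' ! j"
      by (rule vtx_eqD[OF _ _ _ j i(2)]) (use bs in \<open>simp_all add: bit_vectors_def\<close>)
  qed
qed

text \<open>Distinct edges differ in some bit \<open>j\<close> and so, by \<open>vtx_eqD\<close>,
  meet only in classes of \<open>Qs ! j\<close>. Hence any enumeration of \<open>S\<close> works,
  each edge being ordered by class.\<close>

lemma simple_subset_M:
  assumes Qs: "set Qs = \<Q>"
    and S: "S \<subseteq> (\<lambda>bs. vtx Qs bs ` {1..k}) ` bit_vectors (length Qs)"
  shows "simple k \<Q> (vtxs Qs {1..k}, S)"
proof -
  have inj: "inj_on (vtx Qs bs) {1..k}" for bs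
    by (rule inj_onI) (rule vtx_eq_imp_index_eq)
  have "finite S" using S by (rule finite_subset) (simp add: finite_bit_vectors)
  then obtain f where f: "distinct f" "set f = S" using finite_distinct_list by blast
  have "\<forall>i. \<exists>bs. i < length f \<longrightarrow> bs \<in> bit_vectors (length Qs) \<and> f ! i = vtx Qs bs ` {1..k}"
    using S f nth_mem by blast
  then obtain b where b: "\<And>i. i < length f \<Longrightarrow> b i \<in> bit_vectors (length Qs)"
    "\<And>i. i < length f \<Longrightarrow> f ! i = vtx Qs (b i) ` {1..k}" by metis
  have "\<exists>Q\<in>\<Q>. {r \<in> {1..k}. vtx Qs (b i) r \<in> f ! h \<inter> f ! i} \<subseteq> Q" if i: "i < length f" "h < i" for i h
  proof -
    have "f ! h \<noteq> f ! i" using i f by (simp add: nth_eq_iff_index_eq)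
    then have "b h \<noteq> b i" using b(2)[of i] b(2)[of h] i by auto
    moreover have len: "length (b h) = length Qs" "length (b i) = length Qs"
      using b(1)[of i] b(1)[of h] i by (auto simp: bit_vectors_def)
    ultimately obtain j where j: "j < length Qs" "b h ! j \<noteq> b i ! j"
      using nth_equalityI[of "b h" "b i"] by auto
    have "r \<in> Qs ! j" if "vtx Qs (b i) r \<in> f ! h" for r
    proof -
      have "vtx Qs (b i) r = vtx Qs (b h) r"
        using that b(2)[of h] i by (auto dest: vtx_eq_imp_index_eq)
      then show ?thesis using vtx_eqD[OF _ len(2,1) j(1)] j(2) by metis
    qed
    then show ?thesis using Qs j(1) by (intro bexI[of _ "Qs ! j"]) auto
  qed
  moreover have "uniform k (vtxs Qs {1..k}, S)"
    unfolding uniform_def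
  proof (intro conjI ballI)
    fix e assume "e \<in> edges (vtxs Qs {1..k}, S)"
    then obtain bs where bs: "bs \<in> bit_vectors (length Qs)" "e = vtx Qs bs ` {1..k}" using S by auto
    then show "e \<subseteq> verts (vtxs Qs {1..k}, S)" by (auto simp: vtx_in_vtxs)
    show "card e = k" using bs inj by (simp add: card_image)
  qed (simp add: finite_vtxs)
  ultimately show ?thesis
    unfolding simple_def using f b inj
    by (intro conjI exI[of _ f] exI[of _ "\<lambda>i. vtx Qs (b i)"]) (simp_all add: bij_betw_def)
qed

subsection \<open>Deviation\<close>

text \<open>Interpolates between two known averages: \<open>Qs\<close> lists the doublings already
  made, and \<open>R\<close> holds the weights still present on every edge. Empty \<open>Qs\<close>
  gives the average in \<open>avg_disc\<close> up to renaming vertices; empty \<open>R\<close> gives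
  the deviation sum over all maps, normalised.\<close>

definition dev_avg ::
  "nat \<Rightarrow> real \<Rightarrow> 'a hypergraph \<Rightarrow> nat set list \<Rightarrow> nat set set \<Rightarrow> (nat set \<Rightarrow> (nat \<Rightarrow> 'a) \<Rightarrow> real) \<Rightarrow> real" where
  "dev_avg k d H Qs R w = avg (vtxs Qs {1..k}) (verts H)
    (\<lambda>\<phi>. \<Prod>bs\<in>bit_vectors (length Qs). weighted_term k (edges H) d R w (\<phi> \<circ> vtx Qs bs))"

text \<open>On each edge the weight at \<open>Q\<close> sees only classes in \<open>Q\<close>, which
  doubling along \<open>Q\<close> shares. The product of these weights is thus the factor that
  \<open>avg_doubling\<close> drops, and the two copies of the remaining factor are the edges with
  first bit \<open>True\<close> and \<open>False\<close>.\<close>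

lemma dev_avg_doubling:
  assumes V: "finite (verts H)" "verts H \<noteq> {}" and R: "insert Q R \<subseteq> Pow {1..k}" "Q \<notin> R"
    and w: "\<And>Q u. \<bar>w Q u\<bar> \<le> 1"
  shows "(dev_avg k d H Qs (insert Q R) w)\<^sup>2 \<le> dev_avg k d H (Q # Qs) R w"
proof -
  let ?bits = "bit_vectors (length Qs)"
  let ?A = "vtxs Qs ({1..k} \<inter> Q)" and ?B = "vtxs Qs ({1..k} - Q)"
  let ?\<iota> = "\<lambda>b x. if x \<in> ?A then x else Copy x b"
  define W where "W = (\<lambda>\<phi>. \<Prod>bs\<in>?bits. w Q (restrict (\<phi> \<circ> vtx Qs bs) Q))"
  define F where "F = (\<lambda>\<phi>. \<Prod>bs\<in>?bits. weighted_term k (edges H) d R w (\<phi> \<circ> vtx Qs bs))"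
  have "finite R" using R(1) by (intro finite_index_family) auto
  then have split: "weighted_term k (edges H) d (insert Q R) w v
      = w Q (restrict v Q) * weighted_term k (edges H) d R w v" for v
    using R(2) by (simp add: weighted_term_def mult_ac)
  have Un: "?A \<union> ?B = vtxs Qs {1..k}" by (simp add: Int_Diff_Un flip: vtxs_Un)
  have term_dep: "weighted_term k (edges H) d R w u = weighted_term k (edges H) d R w v"
    if "\<And>i. i \<in> {1..k} \<Longrightarrow> u i = v i" for u v
    using weighted_term_depends_on[of R k "edges H" d w] R(1) that
    by (intro depends_onD[where X = "{1..k}" and f = "weighted_term k (edges H) d R w"]) auto
  \<comment> \<open>Shared vertices may themselves be \<open>Copy\<close> terms from earlier
    doublings; comparing roots shows that the new copies do not collide with them.\<close>
  have not_Copy: "Copy x b \<notin> ?A" if "x \<in> ?B" for x b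
  proof
    assume "Copy x b \<in> ?A"
    then have "root (Copy x b) \<in> Q" by (metis IntD2 root_vtx vtxsE)
    moreover have "root x \<notin> Q" using that by (metis DiffD2 root_vtx vtxsE)
    ultimately show False by simp
  qed
  have "(dev_avg k d H Qs (insert Q R) w)\<^sup>2 = (avg (?A \<union> ?B) (verts H) (\<lambda>\<phi>. W \<phi> * F \<phi>))\<^sup>2"
    by (simp only: dev_avg_def W_def F_def split prod.distrib Un)
  also have "\<dots> \<le> avg (?A \<union> ((\<lambda>x. Copy x True) ` ?B \<union> (\<lambda>x. Copy x False) ` ?B)) (verts H)
      (\<lambda>\<phi>. F (\<phi> \<circ> ?\<iota> True) * F (\<phi> \<circ> ?\<iota> False))"
  proof (rule avg_doubling)
    show "?A \<inter> ?B = {}" by (rule vtxs_disjoint) auto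
    show "depends_on (?A \<union> ?B) F"
      unfolding depends_on_def F_def Un using vtx_in_vtxs by (auto intro!: prod.cong term_dep)
    show "depends_on ?A W"
      unfolding depends_on_def W_def using vtx_in_vtxs R(1)
      by (auto intro!: prod.cong arg_cong[where f = "w Q"] restrict_ext)
    show "\<bar>W \<phi>\<bar> \<le> 1" for \<phi>
      unfolding W_def by (intro abs_prod_le_1 w)
  qed (use V not_Copy in \<open>auto simp: finite_vtxs inj_on_def\<close>)
  also have "\<dots> = dev_avg k d H (Q # Qs) R w"
  proof -
    have "F (\<phi> \<circ> ?\<iota> b) = (\<Prod>bs\<in>?bits. weighted_term k (edges H) d R w (\<phi> \<circ> vtx (Q # Qs) (b # bs)))"
      for \<phi> b
      unfolding F_def
    proof (intro prod.cong refl term_dep)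
      fix bs i assume bs: "bs \<in> ?bits" and i: "i \<in> {1..k}"
      have "vtx Qs bs i \<in> ?A \<longleftrightarrow> i \<in> Q"
        using vtx_in_vtxs[OF bs, of i "{1..k} \<inter> Q"] i by (metis IntD2 IntI root_vtx vtxsE)
      then show "(\<phi> \<circ> ?\<iota> b \<circ> vtx Qs bs) i = (\<phi> \<circ> vtx (Q # Qs) (b # bs)) i" by simp
    qed
    then show ?thesis
      by (simp add: dev_avg_def prod_bit_vectors_Suc vtxs_Cons)
  qed
  finally show ?thesis .
qed

text \<open>Each Cauchy--Schwarz step squares the left side. \<open>R\<close> is arbitrary because
  the induction first leaves the head \<open>Q\<close> among the weights, in \<open>R\<close>, and
  then removes it by \<open>dev_avg_doubling\<close>. The absolute value on the right serves the
  case without doublings.\<close>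

lemma avg_weighted_term_power_le_dev_avg:
  assumes V: "finite (verts H)" "verts H \<noteq> {}" and w: "\<And>Q u. \<bar>w Q u\<bar> \<le> 1"
    and "set Qs \<union> R \<subseteq> Pow {1..k}" "distinct Qs" "set Qs \<inter> R = {}"
  shows "\<bar>avg {1..k} (verts H) (weighted_term k (edges H) d (set Qs \<union> R) w)\<bar> ^ (2 ^ length Qs)
    \<le> \<bar>dev_avg k d H Qs R w\<bar>"
  using assms(4-)
proof (induction Qs arbitrary: R)
  case Nil
  have "vtxs [] {1..k} = Orig ` {1..k}" by (auto simp: vtxs_def bit_vectors_0)
  moreover have "vtx [] [] = Orig" by auto
  ultimately have "dev_avg k d H [] R w
      = avg (Orig ` {1..k}) (verts H) (\<lambda>\<phi>. weighted_term k (edges H) d R w (\<phi> \<circ> Orig))"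
    by (simp add: dev_avg_def bit_vectors_0)
  also have "\<dots> = avg {1..k} (verts H) (weighted_term k (edges H) d R w)"
    using Nil by (intro avg_reindex_depends_on weighted_term_depends_on) (auto simp: inj_on_def)
  finally show ?case by simp
next
  case (Cons Q Qs)
  let ?a = "\<bar>avg {1..k} (verts H) (weighted_term k (edges H) d (set (Q # Qs) \<union> R) w)\<bar>"
  have "?a ^ (2 ^ length Qs) \<le> \<bar>dev_avg k d H Qs (insert Q R) w\<bar>"
    using Cons.IH[of "insert Q R"] Cons.prems by simp
  then have "(?a ^ (2 ^ length Qs))\<^sup>2 \<le> \<bar>dev_avg k d H Qs (insert Q R) w\<bar>\<^sup>2"
    by (rule power_mono) simp
  also have "\<dots> \<le> dev_avg k d H (Q # Qs) R w"
    using dev_avg_doubling[where Qs = Qs and R = R and Q = Q, OF V _ _ w] Cons.prems by simp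
  finally show ?case by (simp add: power_mult[symmetric] mult.commute)
qed

lemma DEV_sum_approx:
  fixes M :: "dvertex hypergraph"
  assumes V: "finite (verts H)" "verts H \<noteq> {}" and d: "d \<in> {0..1}"
    and Qs: "set Qs \<subseteq> Pow {1..k} - {{1..k}}"
    and M: "M = (vtxs Qs {1..k}, (\<lambda>bs. vtx Qs bs ` {1..k}) ` bit_vectors (length Qs))"
  shows "\<bar>dev_avg k d H Qs {} w
      - (\<Sum>\<phi>\<in>injections (verts M) (verts H). \<Prod>f\<in>edges M. (indicator (edges H) (\<phi> ` f) - d))
        / real (card (verts H)) ^ card (verts M)\<bar>
    \<le> real ((card (verts M))\<^sup>2) / real (card (verts H))"
proof -
  have "(\<Prod>f\<in>edges M. (indicator (edges H) (\<phi> ` f) - d))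
      = (\<Prod>bs\<in>bit_vectors (length Qs). weighted_term k (edges H) d {} w (\<phi> \<circ> vtx Qs bs))" for \<phi>
    using inj_on_edge[OF Qs] by (simp add: M prod.reindex weighted_term_def image_comp)
  then have "dev_avg k d H Qs {} w
      = avg (verts M) (verts H) (\<lambda>\<phi>. \<Prod>f\<in>edges M. (indicator (edges H) (\<phi> ` f) - d))"
    by (simp add: dev_avg_def M)
  moreover have "\<bar>\<Prod>f\<in>edges M. (indicator (edges H) (\<phi> ` f) - d)\<bar> \<le> 1" for \<phi>
    by (intro abs_prod_le_1 abs_indicator_minus_le_1 d)
  moreover have "finite (verts M)" by (simp add: M finite_vtxs)
  ultimately show ?thesis
    using avg_injections_approx[of "verts M" "verts H" "\<lambda>\<phi>. \<Prod>f\<in>edges M. (indicator (edges H) (\<phi> ` f) - d)"] V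
    by simp
qed

lemma DEV_iff:
  assumes "finite (verts H)" "verts H \<noteq> {}"
  shows "DEV k \<Q> d \<epsilon> H \<longleftrightarrow>
    (\<Sum>\<phi>\<in>injections (verts (M_hypergraph k \<Q>)) (verts H).
      \<Prod>f\<in>edges (M_hypergraph k \<Q>). (indicator (edges H) (\<phi> ` f) - d))
    / real (card (verts H)) ^ card (verts (M_hypergraph k \<Q>)) \<le> \<epsilon>"
proof -
  have "real (card (verts H)) ^ card (verts (M_hypergraph k \<Q>)) > 0"
    using assms by (simp add: card_gt_0_iff)
  then show ?thesis by (simp add: DEV_def Let_def divide_le_eq)
qed

text \<open>Expanding the product over the edges gives a signed sum over sub-hypergraphs. With the
  ideal counts \<open>d ^ card S\<close> it equals \<open>(d - d) ^ card E = 0\<close>, so only the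
  \<open>2 ^ card E\<close> errors remain, with coefficients at most 1 in absolute value.\<close>

lemma abs_dev_avg_le_if_counts:
  fixes H :: "'a hypergraph"
  assumes d: "d \<in> {0..1}"
    and Qs: "set Qs \<subseteq> Pow {1..k} - {{1..k}}"
    and E: "E = (\<lambda>bs. vtx Qs bs ` {1..k}) ` bit_vectors (length Qs)"
    and count: "\<And>S. S \<subseteq> E \<Longrightarrow> \<bar>hom_density (vtxs Qs {1..k}, S) H - d ^ card S\<bar> \<le> \<delta>"
  shows "\<bar>dev_avg k d H Qs {} w\<bar> \<le> 2 ^ card E * \<delta>"
proof -
  have fin: "finite E" by (simp add: E finite_bit_vectors)
  \<comment> \<open>Ensures that the power \<open>0 ^ card E\<close> arising below is 0 and not
    1.\<close>
  have "E \<noteq> {}"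
    unfolding E bit_vectors_def by (auto intro: exI[of _ "replicate (length Qs) True"])
  let ?D = "\<lambda>S. hom_density (vtxs Qs {1..k}, S) H"
  have "dev_avg k d H Qs {} w
      = avg (vtxs Qs {1..k}) (verts H) (\<lambda>\<phi>. \<Prod>f\<in>E. (indicator (edges H) (\<phi> ` f) + - d))"
    using inj_on_edge[OF Qs] by (simp add: dev_avg_def E prod.reindex weighted_term_def image_comp)
  also have "\<dots> = avg (vtxs Qs {1..k}) (verts H)
      (\<lambda>\<phi>. \<Sum>S\<in>Pow E. (- d) ^ card (E - S) * (\<Prod>f\<in>S. indicator (edges H) (\<phi> ` f)))"
    by (simp add: prod_add[OF fin] mult.commute del: add_uminus_conv_diff)
  also have "\<dots> = (\<Sum>S\<in>Pow E. (- d) ^ card (E - S) * ?D S)"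
    by (simp add: avg_sum avg_cmult hom_density_def)
  finally have dev: "dev_avg k d H Qs {} w = (\<Sum>S\<in>Pow E. (- d) ^ card (E - S) * ?D S)" .
  have "(\<Sum>S\<in>Pow E. (- d) ^ card (E - S) * d ^ card S) = (\<Prod>f\<in>E. d + - d)"
    by (subst prod_add[OF fin]) (simp add: mult.commute)
  also have "\<dots> = 0" using \<open>E \<noteq> {}\<close> fin by (simp add: card_gt_0_iff)
  finally have "\<bar>dev_avg k d H Qs {} w\<bar>
      = \<bar>\<Sum>S\<in>Pow E. (- d) ^ card (E - S) * (?D S - d ^ card S)\<bar>"
    by (simp add: dev right_diff_distrib sum_subtractf)
  also have "\<dots> \<le> (\<Sum>S\<in>Pow E. \<bar>(- d) ^ card (E - S) * (?D S - d ^ card S)\<bar>)"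
    by (rule sum_abs)
  also have "\<dots> \<le> (\<Sum>S\<in>Pow E. \<delta>)"
  proof (rule sum_mono)
    fix S assume "S \<in> Pow E"
    then have "\<bar>?D S - d ^ card S\<bar> \<le> \<delta>" using count by blast
    moreover have "\<bar>(- d) ^ card (E - S)\<bar> \<le> 1" using d by (simp add: power_abs power_le_one)
    ultimately have "\<bar>(- d) ^ card (E - S)\<bar> * \<bar>?D S - d ^ card S\<bar> \<le> 1 * \<delta>"
      by (intro mult_mono) auto
    then show "\<bar>(- d) ^ card (E - S) * (?D S - d ^ card S)\<bar> \<le> \<delta>" by (simp add: abs_mult)
  qed
  also have "\<dots> = 2 ^ card E * \<delta>" using fin by (simp add: card_Pow)
  finally show ?thesis .
qed

subsection \<open>Sequences\<close>

context
  fixes k :: nat and \<Q> :: "nat set set" and d :: real and H :: "nat \<Rightarrow> 'a hypergraph"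
  assumes \<Q>: "\<Q> \<subseteq> Pow {1..k} - {{1..k}}" and d: "d \<in> {0..1}" and H: "hypergraph_sequence k H"
begin

definition seq_avg_disc :: bool where
  "seq_avg_disc \<longleftrightarrow> (\<forall>\<epsilon>>0. MOST n. avg_disc k \<Q> d \<epsilon> (H n))"

lemma \<Q>_Pow: "\<Q> \<subseteq> Pow {1..k}"
  using \<Q> by blast

lemma uniform_H: "uniform k (H n)" and card_H: "card (verts (H n)) = n"
  and finite_H: "finite (verts (H n))"
  using H by (auto simp: hypergraph_sequence_def uniform_def)

lemma verts_H_nonempty: "n > 0 \<Longrightarrow> verts (H n) \<noteq> {}"
  using card_H[of n] by auto

lemma seq_DISC_iff: "seq_DISC k \<Q> d H \<longleftrightarrow> seq_avg_disc"
proof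
  assume disc: "seq_DISC k \<Q> d H"
  show seq_avg_disc
    unfolding seq_avg_disc_def
  proof (intro allI impI)
    fix \<epsilon> :: real assume "\<epsilon> > 0"
    \<comment> \<open>Compensates the factor of \<open>avg_disc_if_DISC\<close>; the 2 leaves room
      for the error of injective sums.\<close>
    define \<delta> where "\<delta> = \<epsilon> / (2 * 2 ^ card \<Q>)"
    have \<delta>: "\<delta> > 0" using \<open>\<epsilon> > 0\<close> by (simp add: \<delta>_def)
    then have "MOST n. DISC k \<Q> d \<delta> (H n)" using disc by (simp add: seq_DISC_def)
    then show "MOST n. avg_disc k \<Q> d \<epsilon> (H n)"
      using MOST_const_div_le[OF \<delta>, of "real (k\<^sup>2)"]
    proof eventually_elim
      case (elim n)
      then have "2 ^ card \<Q> * (\<delta> + real (k\<^sup>2) / real n) \<le> 2 ^ card \<Q> * (\<delta> + \<delta>)"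
        by (intro mult_left_mono) auto
      also have "\<dots> = \<epsilon>" by (simp add: \<delta>_def)
      finally show ?case
        using avg_disc_if_DISC[OF \<Q>_Pow d uniform_H verts_H_nonempty, of n \<delta>] elim
        by (auto simp: avg_disc_def card_H intro: order_trans)
    qed
  qed
next
  assume disc: seq_avg_disc
  show "seq_DISC k \<Q> d H"
    unfolding seq_DISC_def
  proof (intro allI impI)
    fix \<epsilon> :: real assume "\<epsilon> > 0"
    then have half: "\<epsilon> / 2 > 0" by simp
    then have "MOST n. avg_disc k \<Q> d (\<epsilon> / 2) (H n)" using disc by (simp add: seq_avg_disc_def)
    then show "MOST n. DISC k \<Q> d \<epsilon> (H n)"
      using MOST_const_div_le[OF half, of "real (k\<^sup>2)"]
    proof eventually_elim
      case (elim n)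
      then have "\<epsilon> / 2 + real (k\<^sup>2) / real n \<le> \<epsilon>" by linarith
      then have "(\<epsilon> / 2 + real (k\<^sup>2) / real n) * real n ^ k \<le> \<epsilon> * real n ^ k"
        by (rule mult_right_mono) simp
      then show ?case
        using DISC_if_avg_disc[OF \<Q>_Pow d uniform_H verts_H_nonempty, of n "\<epsilon> / 2"] elim
        unfolding DISC_def card_H by (meson order_trans)
    qed
  qed
qed

lemma seq_WDISC_iff: "seq_WDISC k \<Q> d H \<longleftrightarrow> seq_avg_disc"
proof
  assume disc: "seq_WDISC k \<Q> d H"
  show seq_avg_disc
    unfolding seq_avg_disc_def
  proof (intro allI impI)
    fix \<epsilon> :: real assume "\<epsilon> > 0"
    then have half: "\<epsilon> / 2 > 0" by simp
    then have "MOST n. WDISC k \<Q> d (\<epsilon> / 2) (H n)" using disc by (simp add: seq_WDISC_def)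
    then show "MOST n. avg_disc k \<Q> d \<epsilon> (H n)"
      using MOST_const_div_le[OF half, of "2 * real (k\<^sup>2)"]
    proof eventually_elim
      case (elim n)
      then have "\<epsilon> / 2 + 2 * real (k\<^sup>2) / real n \<le> \<epsilon>" by simp
      then show ?case
        using avg_disc_if_WDISC[OF \<Q>_Pow d uniform_H verts_H_nonempty, of n "\<epsilon> / 2"] elim
        unfolding avg_disc_def card_H by (meson order_trans)
    qed
  qed
next
  assume disc: seq_avg_disc
  show "seq_WDISC k \<Q> d H"
    unfolding seq_WDISC_def
  proof (intro allI impI)
    fix \<epsilon> :: real assume "\<epsilon> > 0"
    then have "MOST n. avg_disc k \<Q> d \<epsilon> (H n)" using disc by (simp add: seq_avg_disc_def)
    then show "MOST n. WDISC k \<Q> d \<epsilon> (H n)"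
      using MOST_const_div_le[OF \<open>\<epsilon> > 0\<close>, of 0]
      by eventually_elim (use WDISC_if_avg_disc[OF \<Q>_Pow d uniform_H verts_H_nonempty] in blast)
  qed
qed

lemma seq_CL_if_seq_avg_disc:
  assumes seq_avg_disc
  shows "seq_CL k \<Q> d H"
  unfolding seq_CL_def
proof (intro allI impI)
  fix F :: "nat hypergraph" and \<epsilon> :: real assume F: "simple k \<Q> F" and "\<epsilon> > 0"
  \<comment> \<open>The \<open>+ 1\<close> keeps the denominator positive when \<open>F\<close> has
    no edges.\<close>
  define \<delta> where "\<delta> = \<epsilon> / (2 * (real (card (edges F)) + 1))"
  have \<delta>: "\<delta> > 0" "real (card (edges F)) * \<delta> \<le> \<epsilon> / 2"
    using \<open>\<epsilon> > 0\<close> by (simp_all add: \<delta>_def field_simps)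
  have half: "\<epsilon> / 2 > 0" using \<open>\<epsilon> > 0\<close> by simp
  have U: "uniform k F" using F by (simp add: simple_def)
  have "MOST n. avg_disc k \<Q> d \<delta> (H n)" using assms \<delta> by (simp add: seq_avg_disc_def)
  then show "MOST n. CL d F \<epsilon> (H n)"
    using MOST_const_div_le[OF half, of "real ((card (verts F))\<^sup>2)"]
  proof eventually_elim
    case (elim n)
    then have V: "verts (H n) \<noteq> {}" using verts_H_nonempty by simp
    show ?case
      unfolding CL_iff[OF finite_H V] card_H
      using hom_density_approx_if_avg_disc[OF \<Q>_Pow d finite_H V elim(1) F]
        labeled_copies_approx[OF U finite_H V] elim(2) \<delta>(2)
      unfolding card_H by linarith
  qed
qed

text \<open>\<open>seq_CL\<close> speaks of hypergraphs on natural numbers, whereas the subgraphs of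
  \<open>M\<close> live on \<open>dvertex\<close>; a relabelling bridges the types.\<close>

lemma hom_density_if_seq_CL:
  fixes F :: "'b hypergraph"
  assumes CL: "seq_CL k \<Q> d H" and F: "simple k \<Q> F" and "\<epsilon> > 0"
  shows "MOST n. \<bar>hom_density F (H n) - d ^ card (edges F)\<bar> \<le> \<epsilon>"
proof -
  have U: "uniform k F" and fin: "finite (verts F)" using F by (auto simp: simple_def uniform_def)
  obtain h :: "'b \<Rightarrow> nat" where h: "inj_on h (verts F)"
    using finite_imp_inj_to_nat_seg[OF fin] by blast
  define F' where "F' = (h ` verts F, (`) h ` edges F)"
  have F': "simple k \<Q> F'" unfolding F'_def by (rule simple_image[OF F h])
  then have U': "uniform k F'" by (simp add: simple_def)
  have "inj_on ((`) h) (edges F)"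
    using U h by (intro inj_on_subset[OF inj_on_image_Pow[OF h]]) (auto simp: uniform_def)
  then have card: "card (edges F') = card (edges F)" by (simp add: F'_def card_image)
  have half: "\<epsilon> / 2 > 0" using \<open>\<epsilon> > 0\<close> by simp
  have "MOST n. CL d F' (\<epsilon> / 2) (H n)" using CL F' half unfolding seq_CL_def by blast
  then show ?thesis
    using MOST_const_div_le[OF half, of "real ((card (verts F'))\<^sup>2)"]
  proof eventually_elim
    case (elim n)
    then have V: "verts (H n) \<noteq> {}" using verts_H_nonempty by simp
    have "hom_density F' (H n) = hom_density F (H n)"
      unfolding F'_def by (rule hom_density_image[OF U h])
    then show ?case
      using labeled_copies_approx[OF U' finite_H V] elim
      unfolding CL_iff[OF finite_H V] card_H card by linarith
  qed
qed

lemma seq_DEV_if_seq_CL: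
  assumes CL: "seq_CL k \<Q> d H"
  shows "seq_DEV k \<Q> d H"
  unfolding seq_DEV_def
proof (intro allI impI)
  fix \<epsilon> :: real assume "\<epsilon> > 0"
  have "finite \<Q>" using \<Q>_Pow by (rule finite_index_family)
  then obtain Qs where Qs: "set Qs = \<Q>"
    and M: "M_hypergraph k \<Q> = (vtxs Qs {1..k}, (\<lambda>bs. vtx Qs bs ` {1..k}) ` bit_vectors (length Qs))"
    by (rule M_hypergraph_eq)
  define E where "E = (\<lambda>bs. vtx Qs bs ` {1..k}) ` bit_vectors (length Qs)"
  define \<delta> where "\<delta> = \<epsilon> / 2 / 2 ^ card E"
  have \<delta>: "\<delta> > 0" "\<epsilon> / 2 > 0" using \<open>\<epsilon> > 0\<close> by (simp_all add: \<delta>_def)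
  have "finite E" by (simp add: E_def finite_bit_vectors)
  have "MOST n. \<bar>hom_density (vtxs Qs {1..k}, S) (H n) - d ^ card S\<bar> \<le> \<delta>" if "S \<in> Pow E" for S
    using hom_density_if_seq_CL[OF CL simple_subset_M[OF Qs] \<delta>(1), of S] that by (simp add: E_def)
  then have "MOST n. \<forall>S\<in>Pow E. \<bar>hom_density (vtxs Qs {1..k}, S) (H n) - d ^ card S\<bar> \<le> \<delta>"
    using \<open>finite E\<close> by (intro eventually_ball_finite) auto
  then show "MOST n. DEV k \<Q> d \<epsilon> (H n)"
    using MOST_const_div_le[OF \<delta>(2), of "real ((card (verts (M_hypergraph k \<Q>)))\<^sup>2)"]
  proof eventually_elim
    case (elim n)
    then have V: "verts (H n) \<noteq> {}" using verts_H_nonempty by simp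
    have sub: "set Qs \<subseteq> Pow {1..k} - {{1..k}}" using Qs \<Q> by simp
    \<comment> \<open>The weight 0 is a placeholder and does not annihilate the average: over the
      empty family the product of weights is 1.\<close>
    have "\<bar>dev_avg k d (H n) Qs {} (\<lambda>_ _. 0)\<bar> \<le> 2 ^ card E * \<delta>"
      by (rule abs_dev_avg_le_if_counts[OF d sub E_def]) (use elim(1) in blast)
    also have "\<dots> = \<epsilon> / 2" by (simp add: \<delta>_def)
    finally show ?case
      unfolding DEV_iff[OF finite_H V]
      using DEV_sum_approx[OF finite_H V d sub M, of "\<lambda>_ _. 0"] elim(2) unfolding card_H by linarith
  qed
qed

lemma seq_avg_disc_if_seq_DEV:
  assumes DEV: "seq_DEV k \<Q> d H" and "\<Q> \<noteq> {}"
  shows seq_avg_disc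
  unfolding seq_avg_disc_def
proof (intro allI impI)
  fix \<epsilon> :: real assume "\<epsilon> > 0"
  have "finite \<Q>" using \<Q>_Pow by (rule finite_index_family)
  then obtain Qs where Qs: "distinct Qs" "set Qs = \<Q>"
    and M: "M_hypergraph k \<Q> = (vtxs Qs {1..k}, (\<lambda>bs. vtx Qs bs ` {1..k}) ` bit_vectors (length Qs))"
    by (rule M_hypergraph_eq)
  define N :: nat where "N = 2 ^ length Qs"
  have "N > 0" by (simp add: N_def)
  \<comment> \<open>An \<open>N\<close>-th root is taken at the end; the other half pays for the
    noninjective maps.\<close>
  have half: "\<epsilon> ^ N / 2 > 0" using \<open>\<epsilon> > 0\<close> by simp
  then have "MOST n. DEV k \<Q> d (\<epsilon> ^ N / 2) (H n)" using DEV by (simp add: seq_DEV_def)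
  then show "MOST n. avg_disc k \<Q> d \<epsilon> (H n)"
    using MOST_const_div_le[OF half, of "real ((card (verts (M_hypergraph k \<Q>)))\<^sup>2)"]
  proof eventually_elim
    case (elim n)
    then have V: "verts (H n) \<noteq> {}" using verts_H_nonempty by simp
    have sub: "set Qs \<subseteq> Pow {1..k} - {{1..k}}" using Qs \<Q> by simp
    show ?case
      unfolding avg_disc_def
    proof (intro allI impI)
      fix w :: "nat set \<Rightarrow> (nat \<Rightarrow> 'a) \<Rightarrow> real" assume w: "\<forall>Q u. \<bar>w Q u\<bar> \<le> 1"
      let ?a = "\<bar>avg {1..k} (verts (H n)) (weighted_term k (edges (H n)) d \<Q> w)\<bar>"
      have "dev_avg k d (H n) Qs {} w \<le> \<epsilon> ^ N"
        using DEV_sum_approx[OF finite_H V d sub M, of w] elim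
        unfolding DEV_iff[OF finite_H V] card_H by linarith
      \<comment> \<open>Undoing the outermost doubling shows that the sum dominates a square; this
        replaces the missing absolute value in deviation.\<close>
      moreover have "0 \<le> dev_avg k d (H n) Qs {} w"
      proof -
        obtain Q Qs' where Q: "Qs = Q # Qs'" using \<open>\<Q> \<noteq> {}\<close> Qs by (cases Qs) auto
        have "0 \<le> (dev_avg k d (H n) Qs' {Q} w)\<^sup>2" by simp
        also have "\<dots> \<le> dev_avg k d (H n) Qs {} w"
          unfolding Q by (rule dev_avg_doubling[OF finite_H V]) (use w Q Qs \<Q>_Pow in auto)
        finally show ?thesis .
      qed
      moreover have "?a ^ N \<le> \<bar>dev_avg k d (H n) Qs {} w\<bar>"
        using avg_weighted_term_power_le_dev_avg[where Qs = Qs and R = "{}" and w = w and k = k and d = d,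
            OF finite_H V] w Qs \<Q>_Pow
        by (simp add: N_def)
      ultimately have "?a ^ N \<le> \<epsilon> ^ N" by simp
      then show "?a \<le> \<epsilon>" using \<open>N > 0\<close> \<open>\<epsilon> > 0\<close> by (simp add: power_mono_iff)
    qed
  qed
qed

text \<open>For empty \<open>\<Q>\<close> the product of weights is 1, and \<open>avg_disc\<close>
  only compares the edge density with \<open>d\<close>, which is counting for a single edge.\<close>

lemma seq_avg_disc_if_seq_CL:
  assumes CL: "seq_CL k \<Q> d H"
  shows seq_avg_disc
proof (cases "\<Q> = {}")
  case False
  then show ?thesis using seq_avg_disc_if_seq_DEV seq_DEV_if_seq_CL CL by blast
next
  case True
  \<comment> \<open>One edge alone is simple even for the empty family, as there is no earlier edge
    for which a member of \<open>\<Q>\<close> would be required.\<close>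
  define F where "F = ({1..k}, {{1..k}})"
  have "simple k \<Q> F"
    unfolding simple_def
  proof (intro conjI exI)
    show "uniform k F" by (simp add: uniform_def F_def)
    show "distinct [{1..k}]" "set [{1..k}] = edges F" by (simp_all add: F_def)
    show "\<forall>i<length [{1..k}]. bij_betw ((\<lambda>_ r. r) i) {1..k} ([{1..k}] ! i)"
      by (simp add: bij_betw_def)
  qed simp
  have "MOST n. avg_disc k \<Q> d \<epsilon> (H n)" if \<epsilon>: "\<epsilon> > 0" for \<epsilon>
    using hom_density_if_seq_CL[OF CL \<open>simple k \<Q> F\<close> \<epsilon>] MOST_const_div_le[OF \<epsilon>, of 0]
  proof eventually_elim
    case (elim n)
    then have V: "verts (H n) \<noteq> {}" using verts_H_nonempty by simp
    have "avg {1..k} (verts (H n)) (weighted_term k (edges (H n)) d \<Q> w) = hom_density F (H n) - d" for w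
    proof -
      have "weighted_term k (edges (H n)) d \<Q> w = (\<lambda>v. indicator (edges (H n)) (v ` {1..k}) - d)"
        using True by (auto simp: weighted_term_def)
      then show ?thesis
        by (simp add: avg_diff avg_const[OF _ finite_H V] hom_density_def F_def del: One_nat_def)
    qed
    then show ?case using elim(1) by (simp add: avg_disc_def F_def)
  qed
  then show ?thesis by (simp add: seq_avg_disc_def)
qed

end

theorem theorem2p8:
  fixes k :: nat and \<Q> :: "nat set set" and d :: real
    and H :: "nat \<Rightarrow> 'a hypergraph"
  assumes "k \<ge> 2"
    and "\<Q> \<subseteq> Pow {1..k} - {{1..k}}"
    and "d \<in> {0..1}"
    and "hypergraph_sequence k H"
  shows "(seq_DISC k \<Q> d H \<longleftrightarrow> seq_WDISC k \<Q> d H) \<and>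
         (seq_WDISC k \<Q> d H \<longleftrightarrow> seq_CL k \<Q> d H) \<and>
         (seq_CL k \<Q> d H \<longrightarrow> seq_DEV k \<Q> d H) \<and>
         (\<Q> \<noteq> {} \<longrightarrow> seq_DEV k \<Q> d H \<longrightarrow> seq_DISC k \<Q> d H)"
  using assms(2-4) seq_DISC_iff seq_WDISC_iff seq_CL_if_seq_avg_disc seq_avg_disc_if_seq_CL
    seq_DEV_if_seq_CL seq_avg_disc_if_seq_DEV
  by metis

end
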